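(* Let $k$ be an algebraically closed field of characteristic $p\ge 5$ and let $(\mathfrak g,[p])$ be a finite-dimensional restricted Lie algebra over $k$ that is generically toral (i.e. possesses a self-centralizing torus) and satisfies $\mathrm{rk}_p(\mathfrak g)=1$. Then $\mathfrak g/C(\mathfrak g)$ is isomorphic to one of \[ \mathfrak{sl}(2),\quad \mathfrak b_{\mathfrak{sl}(2)},\quad \mathfrak b_{\mathfrak{sl}(2)}^{-1}, \] and moreover $C(\mathfrak g)\neq(0)$ in the case where $\mathfrak g/C(\mathfrak g)\cong\mathfrak b_{\mathfrak{sl}(2)}^{-1}$.
   Context: $C(\mathfrak g)$ denotes the center of $\mathfrak g$. A torus of $\mathfrak g$ is an abelian $p$-subalgebra on which the $p$-map is bijective; it is self-centralizing if it equals its centralizer $C_{\mathfrak g}(\mathfrak t)$. A restricted Lie algebra is generically toral if it contains a self-centralizing torus. Put $V(\mathfrak g)=\{x\in\mathfrak g: x^{[p]}=0\}$ and, for $r\ge 0$, let $\mathbb E(r,\mathfrak g)$ be the set of $r$-dimensional subspaces $\mathfrak e\subseteq\mathfrak g$ with $[\mathfrak e,\mathfrak e]=(0)$ and $\mathfrak e\subseteq V(\mathfrak g)$. The $p$-rank is $\mathrm{rk}_p(\mathfrak g)=\max\{r\in\mathbb N_0:\mathbb E(r,\mathfrak g)\neq\emptyset\}$. $\mathfrak b_{\mathfrak{sl}(2)}=kt\oplus kx$ is the standard Borel subalgebra of $\mathfrak{sl}(2)$, with $[t,x]=x$, $t^{[p]}=t$, $x^{[p]}=0$. The restricted Lie algebra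 $\mathfrak b_{\mathfrak{sl}(2)}^{-1}=kt\oplus kx\oplus ky$ is given by $[t,x]=x$, $[t,y]=-y$, $[x,y]=0$, $t^{[p]}=t$, $x^{[p]}=0=y^{[p]}$. *)

theory Defs
  imports "HOL-Analysis.Analysis"
begin

section \<open>Restricted Lie algebras\<close>

locale lie_algebra = vector_space scale
  for scale :: "'k::field \<Rightarrow> 'g::ab_group_add \<Rightarrow> 'g" +
  fixes bracket :: "'g \<Rightarrow> 'g \<Rightarrow> 'g"
  assumes bracket_add_left: "bracket (x + y) z = bracket x z + bracket y z"
    and bracket_add_right: "bracket x (y + z) = bracket x y + bracket x z"
    and bracket_scale_left: "bracket (scale c x) y = scale c (bracket x y)"
    and bracket_scale_right: "bracket x (scale c y) = scale c (bracket x y)"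
    and bracket_self: "bracket x x = 0"
    and jacobi: "bracket x (bracket y z) + bracket y (bracket z x) + bracket z (bracket x y) = 0"
begin

text \<open>
  \<open>ad_coeff x y n j\<close> is the coefficient of \<open>T\<^sup>j\<close> in \<open>ad(T x + y)\<^sup>n (x)\<close>, computed in
  \<open>\<gg> \<otimes> k[T]\<close>.
\<close>

fun ad_coeff :: "'g \<Rightarrow> 'g \<Rightarrow> nat \<Rightarrow> nat \<Rightarrow> 'g" where
  "ad_coeff x y 0 j = (if j = 0 then x else 0)"
| "ad_coeff x y (Suc n) j =
     (case j of 0 \<Rightarrow> 0 | Suc i \<Rightarrow> bracket x (ad_coeff x y n i)) + bracket y (ad_coeff x y n j)"

text \<open>
  With \<open>p = char k\<close>, the polynomials \<open>s\<^sub>i(x, y)\<close> of Jacobson's formula are determined by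
  \<open>ad(T x + y)\<^bsup>p-1\<^esup>(x) = \<Sum>\<^bsub>1 \<le> i < p\<^esub> i s\<^sub>i(x, y) T\<^bsup>i-1\<^esup>\<close>.
\<close>

definition jacobson :: "nat \<Rightarrow> 'g \<Rightarrow> 'g \<Rightarrow> 'g" where
  "jacobson i x y = scale (inverse (of_nat i)) (ad_coeff x y (CHAR('k) - 1) (i - 1))"

definition center :: "'g set" where
  "center = {z. \<forall>x. bracket z x = 0}"

definition centralizer :: "'g set \<Rightarrow> 'g set" where
  "centralizer S = {x. \<forall>s\<in>S. bracket x s = 0}"

definition abelian :: "'g set \<Rightarrow> bool" where
  "abelian S \<longleftrightarrow> (\<forall>x\<in>S. \<forall>y\<in>S. bracket x y = 0)"

definition lie_subalgebra :: "'g set \<Rightarrow> bool" where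
  "lie_subalgebra S \<longleftrightarrow> subspace S \<and> (\<forall>x\<in>S. \<forall>y\<in>S. bracket x y \<in> S)"

definition lie_ideal :: "'g set \<Rightarrow> bool" where
  "lie_ideal I \<longleftrightarrow> subspace I \<and> (\<forall>x. \<forall>y\<in>I. bracket x y \<in> I)"

end

locale restricted_lie_algebra = lie_algebra scale bracket
  for scale :: "'k::field \<Rightarrow> 'g::ab_group_add \<Rightarrow> 'g" and bracket :: "'g \<Rightarrow> 'g \<Rightarrow> 'g" +
  fixes pmap :: "'g \<Rightarrow> 'g"
  assumes CHAR_pos: "CHAR('k) > 0"
    and ad_pmap: "bracket (pmap x) y = (bracket x ^^ CHAR('k)) y"
    and pmap_scale: "pmap (scale c x) = scale (c ^ CHAR('k)) (pmap x)"
    and pmap_add: "pmap (x + y) = pmap x + pmap y + (\<Sum>i = 1..<CHAR('k). jacobson i x y)"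
begin

definition p_subalgebra :: "'g set \<Rightarrow> bool" where
  "p_subalgebra S \<longleftrightarrow> lie_subalgebra S \<and> pmap ` S \<subseteq> S"

definition p_ideal :: "'g set \<Rightarrow> bool" where
  "p_ideal I \<longleftrightarrow> lie_ideal I \<and> pmap ` I \<subseteq> I"

definition torus :: "'g set \<Rightarrow> bool" where
  "torus T \<longleftrightarrow> p_subalgebra T \<and> abelian T \<and> bij_betw pmap T T"

definition self_centralizing :: "'g set \<Rightarrow> bool" where
  "self_centralizing T \<longleftrightarrow> centralizer T = T"

definition generically_toral :: bool where
  "generically_toral \<longleftrightarrow> (\<exists>T. torus T \<and> self_centralizing T)"

definition nullcone :: "'g set" where
  "nullcone = {x. pmap x = 0}"

definition elementary_subalgebras :: "nat \<Rightarrow> 'g set set" where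
  "elementary_subalgebras r = {E. subspace E \<and> dim E = r \<and> abelian E \<and> E \<subseteq> nullcone}"

end

text \<open>
  The \<open>p\<close>-rank is defined for finite-dimensional algebras only: \<open>dim\<close> is \<open>0\<close> on
  subspaces without a finite basis, and \<open>Max\<close> is meaningful on finite nonempty sets only.
\<close>

locale fin_dim_restricted_lie_algebra = restricted_lie_algebra scale bracket pmap
  for scale :: "'k::field \<Rightarrow> 'g::ab_group_add \<Rightarrow> 'g" and bracket :: "'g \<Rightarrow> 'g \<Rightarrow> 'g"
    and pmap :: "'g \<Rightarrow> 'g" +
  assumes fin_dim: "\<exists>B. finite_dimensional_vector_space scale B"
begin

definition p_rank :: nat where
  "p_rank = Max {r. elementary_subalgebras r \<noteq> {}}"

lemma p_rank_well_defined:
  "finite {r. elementary_subalgebras r \<noteq> {}}" "{r. elementary_subalgebras r \<noteq> {}} \<noteq> {}"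
proof -
  obtain B where "finite_dimensional_vector_space scale B"
    using fin_dim by blast
  then interpret fd: finite_dimensional_vector_space scale B .
  have "{r. elementary_subalgebras r \<noteq> {}} \<subseteq> {..dim UNIV}"
    using fd.dim_subset[OF subset_UNIV] by (auto simp: elementary_subalgebras_def simp del: fd.dim_UNIV)
  then show "finite {r. elementary_subalgebras r \<noteq> {}}"
    using finite_subset by blast
  have "pmap 0 = 0"
    using pmap_scale[of 0 0] CHAR_pos by (simp add: power_0_left)
  then have "{0} \<in> elementary_subalgebras (dim {0})"
    using bracket_self[of 0]
    by (simp add: elementary_subalgebras_def abelian_def nullcone_def subspace_def)
  then show "{r. elementary_subalgebras r \<noteq> {}} \<noteq> {}"
    by blast
qed

end


section \<open>Structures on a carrier set, quotients and isomorphism\<close>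

record ('k, 'a) lie_struct =
  carr :: "'a set"
  ladd :: "'a \<Rightarrow> 'a \<Rightarrow> 'a"
  lscale :: "'k \<Rightarrow> 'a \<Rightarrow> 'a"
  lbracket :: "'a \<Rightarrow> 'a \<Rightarrow> 'a"
  lpmap :: "'a \<Rightarrow> 'a"

definition restricted_iso ::
    "('k, 'a) lie_struct \<Rightarrow> ('k, 'b) lie_struct \<Rightarrow> ('a \<Rightarrow> 'b) \<Rightarrow> bool" where
  "restricted_iso L M f \<longleftrightarrow>
     bij_betw f (carr L) (carr M) \<and>
     (\<forall>x\<in>carr L. \<forall>y\<in>carr L. f (ladd L x y) = ladd M (f x) (f y)) \<and>
     (\<forall>c. \<forall>x\<in>carr L. f (lscale L c x) = lscale M c (f x)) \<and>
     (\<forall>x\<in>carr L. \<forall>y\<in>carr L. f (lbracket L x y) = lbracket M (f x) (f y)) \<and>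
     (\<forall>x\<in>carr L. f (lpmap L x) = lpmap M (f x))"

definition restricted_isomorphic ::
    "('k, 'a) lie_struct \<Rightarrow> ('k, 'b) lie_struct \<Rightarrow> bool" (infix \<open>\<cong>\<^sub>p\<close> 50) where
  "L \<cong>\<^sub>p M \<longleftrightarrow> (\<exists>f. restricted_iso L M f)"

context restricted_lie_algebra
begin

definition cosets :: "'g set \<Rightarrow> ('g \<times> 'g) set" where
  "cosets I = {(x, y). x - y \<in> I}"

definition quotient_algebra :: "'g set \<Rightarrow> ('k, 'g set) lie_struct" where
  "quotient_algebra I =
    \<lparr> carr = UNIV // cosets I,
      ladd = (\<lambda>X Y. \<Union>x\<in>X. \<Union>y\<in>Y. cosets I `` {x + y}),
      lscale = (\<lambda>c X. \<Union>x\<in>X. cosets I `` {scale c x}),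
      lbracket = (\<lambda>X Y. \<Union>x\<in>X. \<Union>y\<in>Y. cosets I `` {bracket x y}),
      lpmap = (\<lambda>X. \<Union>x\<in>X. cosets I `` {pmap x}) \<rparr>"

lemma bracket_zero_left [simp]: "bracket 0 x = 0"
  using bracket_scale_left[of 0 0 x] by simp

lemma bracket_zero_right [simp]: "bracket x 0 = 0"
  using bracket_scale_right[of x 0 0] by simp

lemma bracket_minus_left: "bracket (- x) y = - bracket x y"
  using bracket_scale_left[of "-1" x y] by simp

lemma bracket_minus_right: "bracket x (- y) = - bracket x y"
  using bracket_scale_right[of x "-1" y] by simp

lemma bracket_diff_left: "bracket (x - y) z = bracket x z - bracket y z"
  using bracket_add_left[of x "-y" z] bracket_minus_left[of y z] by simp

lemma bracket_diff_right: "bracket x (y - z) = bracket x y - bracket x z"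
  using bracket_add_right[of x y "-z"] bracket_minus_right[of x z] by simp

lemma bracket_skew: "bracket x y = - bracket y x"
proof -
  have "bracket (x + y) (x + y) = bracket x y + bracket y x"
    unfolding bracket_add_left bracket_add_right by (simp add: bracket_self)
  then show ?thesis
    using bracket_self[of "x + y"] eq_neg_iff_add_eq_0[of "bracket x y" "bracket y x"] by simp
qed

lemma CHAR_gt_1: "CHAR('k) > 1"
  using CHAR_pos CHAR_not_1'[where ?'a = 'k] by linarith

lemma center_subspace: "subspace center"
  by (simp add: subspace_def center_def bracket_add_left bracket_scale_left)

lemma centerI: "(\<And>x. bracket z x = 0) \<Longrightarrow> z \<in> center"
  by (simp add: center_def)

lemma centerD: "z \<in> center \<Longrightarrow> bracket z x = 0" "z \<in> center \<Longrightarrow> bracket x z = 0"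
proof -
  show *: "bracket z x = 0" if "z \<in> center" for x
    using that by (simp add: center_def)
  show "bracket x z = 0" if "z \<in> center"
    using *[OF that, of x] by (simp add: bracket_skew[of x z])
qed

lemma p_ideal_center: "p_ideal center"
proof -
  have "pmap z \<in> center" if "z \<in> center" for z
  proof (rule centerI)
    fix x
    have "bracket z = (\<lambda>y. 0)"
      using centerD(1)[OF that] by (rule ext)
    moreover obtain n where "CHAR('k) = Suc n"
      using CHAR_pos gr0_conv_Suc by blast
    ultimately show "bracket (pmap z) x = 0"
      using ad_pmap[of z x] by simp
  qed
  moreover have "bracket x z \<in> center" if "z \<in> center" for x z
    unfolding centerD(2)[OF that] by (rule subspace_0[OF center_subspace])
  ultimately show ?thesis
    unfolding p_ideal_def lie_ideal_def using center_subspace by blast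
qed

lemma pmap_add_center:
  assumes "z \<in> center"
  shows "pmap (x + z) = pmap x + pmap z"
proof -
  have ad: "ad_coeff x z (Suc n) j = 0" for n j
    by (induction n arbitrary: j) (auto simp: centerD[OF assms] bracket_self split: nat.split)
  obtain n where "CHAR('k) - 1 = Suc n"
    using CHAR_gt_1 gr0_conv_Suc[of "CHAR('k) - 1"] by auto
  then have "jacobson i x z = 0" for i
    unfolding jacobson_def by (simp only: ad scale_zero_right)
  then show ?thesis
    using pmap_add[of x z] by simp
qed

lemma equiv_cosets:
  assumes "subspace I"
  shows "equiv UNIV (cosets I)"
proof (rule equivI)
  show "refl (cosets I)"
    using assms by (simp add: refl_on_def cosets_def subspace_0)
  show "sym (cosets I)"
  proof (rule symI)
    fix x y assume "(x, y) \<in> cosets I"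
    then have "- (x - y) \<in> I"
      using assms by (intro subspace_neg) (auto simp: cosets_def)
    then show "(y, x) \<in> cosets I"
      by (simp add: cosets_def)
  qed
  show "trans (cosets I)"
  proof (rule transI)
    fix x y z assume "(x, y) \<in> cosets I" "(y, z) \<in> cosets I"
    then have "(x - y) + (y - z) \<in> I"
      using assms by (intro subspace_add) (auto simp: cosets_def)
    then show "(x, z) \<in> cosets I"
      by (simp add: cosets_def)
  qed
qed auto

text \<open>The operations of the quotient by the center are independent of representatives.\<close>

lemma quotient_center_simps:
  defines "Q \<equiv> quotient_algebra center" and "q \<equiv> \<lambda>x. cosets center `` {x}"
  shows "ladd Q (q x) (q y) = q (x + y)"
    and "lscale Q c (q x) = q (scale c x)"
    and "lbracket Q (q x) (q y) = q (bracket x y)"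
    and "lpmap Q (q x) = q (pmap x)"
    and "carr Q = range q"
proof -
  note eq = equiv_cosets[OF center_subspace]
  have eqI: "q a = q b" if "a - b \<in> center" for a b
    unfolding q_def using that eq by (intro equiv_class_eq) (auto simp: cosets_def)
  have addc: "a + b \<in> center" if "a \<in> center" "b \<in> center" for a b
    using that center_subspace by (rule subspace_add[rotated])
  have mem: "a - b \<in> center" if "(a, b) \<in> cosets center" for a b
    using that by (simp add: cosets_def)
  have c1: "congruent2 (cosets center) (cosets center) (\<lambda>x y. q (x + y))"
  proof (rule congruent2I')
    fix a b c d assume "(a, b) \<in> cosets center" "(c, d) \<in> cosets center"
    from addc[OF mem[OF this(1)] mem[OF this(2)]] show "q (a + c) = q (b + d)"
      by (intro eqI) (simp add: algebra_simps)
  qed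
  have c2: "congruent (cosets center) (\<lambda>x. q (scale c x))"
  proof (rule congruentI)
    fix a b assume "(a, b) \<in> cosets center"
    then have "scale c (a - b) \<in> center"
      by (intro subspace_scale center_subspace mem)
    then show "q (scale c a) = q (scale c b)"
      by (intro eqI) (simp only: scale_right_diff_distrib)
  qed
  have c3: "congruent2 (cosets center) (cosets center) (\<lambda>x y. q (bracket x y))"
  proof (rule congruent2I')
    fix a b c d assume "(a, b) \<in> cosets center" "(c, d) \<in> cosets center"
    then have "bracket (a - b) c = 0" "bracket b (c - d) = 0"
      by (auto dest!: mem intro: centerD)
    then show "q (bracket a c) = q (bracket b d)"
      by (simp add: bracket_diff_left bracket_diff_right)
  qed
  have c4: "congruent (cosets center) (\<lambda>x. q (pmap x))"
  proof (rule congruentI)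
    fix a b assume "(a, b) \<in> cosets center"
    then have "a - b \<in> center" by (rule mem)
    then have "pmap a = pmap b + pmap (a - b)" "pmap (a - b) \<in> center"
      using pmap_add_center[of "a - b" b] p_ideal_center by (auto simp: p_ideal_def)
    then show "q (pmap a) = q (pmap b)"
      by (intro eqI) simp
  qed
  show "ladd Q (q x) (q y) = q (x + y)"
    using UN_equiv_class2[OF eq eq c1, of x y] by (simp add: Q_def quotient_algebra_def q_def)
  show "lscale Q c (q x) = q (scale c x)"
    using UN_equiv_class[OF eq c2, of x] by (simp add: Q_def quotient_algebra_def q_def)
  show "lbracket Q (q x) (q y) = q (bracket x y)"
    using UN_equiv_class2[OF eq eq c3, of x y] by (simp add: Q_def quotient_algebra_def q_def)
  show "lpmap Q (q x) = q (pmap x)"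
    using UN_equiv_class[OF eq c4, of x] by (simp add: Q_def quotient_algebra_def q_def)
  show "carr Q = range q"
    by (auto simp: Q_def quotient_algebra_def q_def quotient_def)
qed

end


section \<open>The algebras in the classification\<close>

definition mat_power :: "'k::comm_ring_1^'n^'n \<Rightarrow> nat \<Rightarrow> 'k^'n^'n" where
  "mat_power A m = ((\<lambda>B. A ** B) ^^ m) (mat 1)"

definition matrix_lie_struct :: "('k::comm_ring_1^'n^'n) set \<Rightarrow> ('k, 'k^'n^'n) lie_struct" where
  "matrix_lie_struct S =
    \<lparr> carr = S,
      ladd = (+),
      lscale = (\<lambda>c A. \<chi> i j. c * A$i$j),
      lbracket = (\<lambda>A B. A ** B - B ** A),
      lpmap = (\<lambda>A. mat_power A CHAR('k)) \<rparr>"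

definition sl2 :: "('k::field, 'k^2^2) lie_struct" where
  "sl2 = matrix_lie_struct {A. trace A = 0}"

definition borel_sl2 :: "('k::field, 'k^2^2) lie_struct" where
  "borel_sl2 = matrix_lie_struct {A. trace A = 0 \<and> A$2$1 = 0}"

text \<open>
  The algebra \<open>kt \<oplus> kx \<oplus> ky\<close> in coordinates with respect to \<open>t, x, y\<close>. The \<open>p\<close>-map is the
  one forced by its values on the basis through Jacobson's formula (\<open>p\<close> odd):
  \<open>(a t + v)\<^bsup>[p]\<^esup> = a\<^sup>p t + a\<^bsup>p-1\<^esup> v\<close> for \<open>v \<in> kx \<oplus> ky\<close>.
\<close>

type_synonym 'k triple = "'k \<times> 'k \<times> 'k"

fun bm_scale :: "'k::field \<Rightarrow> 'k triple \<Rightarrow> 'k triple" where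
  "bm_scale r (a, b, c) = (r * a, r * b, r * c)"

fun bm_bracket :: "'k::field triple \<Rightarrow> 'k triple \<Rightarrow> 'k triple" where
  "bm_bracket (a, b, c) (a', b', c') = (0, a * b' - a' * b, - (a * c' - a' * c))"

fun bm_pmap :: "'k::field triple \<Rightarrow> 'k triple" where
  "bm_pmap (a, b, c) = (a ^ CHAR('k), a ^ (CHAR('k) - 1) * b, a ^ (CHAR('k) - 1) * c)"

definition borel_sl2_minus :: "('k::field, 'k triple) lie_struct" where
  "borel_sl2_minus =
    \<lparr> carr = UNIV, ladd = (+), lscale = bm_scale, lbracket = bm_bracket, lpmap = bm_pmap \<rparr>"

text \<open>
  The displayed data do define a finite-dimensional restricted Lie algebra, with the prescribed
  brackets and \<open>p\<close>-th powers of \<open>t = (1, 0, 0)\<close>, \<open>x = (0, 1, 0)\<close>, \<open>y = (0, 0, 1)\<close>.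
\<close>

lemma bm_relations:
  assumes "CHAR('k::field) > 2"
  defines "t \<equiv> (1, 0, 0) :: 'k triple" and "x \<equiv> (0, 1, 0)" and "y \<equiv> (0, 0, 1)"
  shows "bm_bracket t x = x" "bm_bracket t y = - y" "bm_bracket x y = 0"
    and "bm_pmap t = t" "bm_pmap x = 0" "bm_pmap y = 0"
  using assms(1) by (auto simp: t_def x_def y_def zero_prod_def)

lemma lie_algebra_bm: "lie_algebra bm_scale (bm_bracket :: 'k::field triple \<Rightarrow> _)"
  by unfold_locales (auto simp: algebra_simps zero_prod_def)

lemma bm_ad_power:
  "(bm_bracket (a, b, c) ^^ Suc n) (a', b', c') =
    (0, a ^ n * (a * b' - a' * b), (-1) ^ Suc n * (a ^ n * (a * c' - a' * c)))"
  by (induction n) (simp_all add: algebra_simps)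

lemma bm_ad_coeff:
  "lie_algebra.ad_coeff bm_bracket (a, b, c) (a', b', c') (Suc n) j =
    (0, of_nat (n choose j) * (a ^ j * a' ^ (n - j)) * (a' * b - a * b'),
     (-1) ^ Suc n * (of_nat (n choose j) * (a ^ j * a' ^ (n - j)) * (a' * c - a * c')))"
proof (induction n arbitrary: j)
  interpret lie_algebra bm_scale bm_bracket by (rule lie_algebra_bm)
  {
    case 0
    show ?case
      by (cases j) (auto simp: zero_prod_def algebra_simps split: nat.split)
  next
    case (Suc n)
    have *: "of_nat (n choose i) * (a ^ i * a' ^ (Suc n - i))
        = a' * (of_nat (n choose i) * (a ^ i * a' ^ (n - i)))" for i
      by (cases "i \<le> n") (simp_all add: Suc_diff_le binomial_eq_0)
    show ?case
    proof (cases j)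
      case 0
      then show ?thesis
        unfolding ad_coeff.simps(2)[of _ _ "Suc n"] Suc.IH by (simp add: algebra_simps)
    next
      case (Suc i)
      define P where "P = of_nat (n choose i) * (a ^ i * a' ^ (n - i))"
      define Q where "Q = of_nat (n choose j) * (a ^ j * a' ^ (n - j))"
      have R: "of_nat (Suc n choose j) * (a ^ j * a' ^ (Suc n - j)) = a * P + a' * Q"
      proof -
        have "of_nat (Suc n choose j) * (a ^ j * a' ^ (Suc n - j))
            = of_nat (n choose i) * (a ^ j * a' ^ (Suc n - j))
            + of_nat (n choose j) * (a ^ j * a' ^ (Suc n - j))"
          unfolding Suc binomial_Suc_Suc of_nat_add by (rule distrib_right)
        also have "of_nat (n choose i) * (a ^ j * a' ^ (Suc n - j)) = a * P"
          by (simp add: Suc P_def)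
        finally show ?thesis
          unfolding * Q_def .
      qed
      have IHi: "ad_coeff (a, b, c) (a', b', c') (Suc n) i =
          (0, P * (a' * b - a * b'), (-1) ^ Suc n * (P * (a' * c - a * c')))"
        unfolding P_def by (rule Suc.IH)
      show ?thesis
        unfolding ad_coeff.simps(2)[of _ _ "Suc n"] Suc.IH[of j] R Q_def[symmetric]
        by (simp add: Suc IHi algebra_simps del: ad_coeff.simps)
    qed
  }
qed

lemma fin_dim_restricted_lie_algebra_bm:
  assumes "CHAR('k::field) > 2"
  shows "fin_dim_restricted_lie_algebra bm_scale (bm_bracket :: 'k triple \<Rightarrow> _) bm_pmap"
proof -
  interpret lie_algebra bm_scale "bm_bracket :: 'k triple \<Rightarrow> _" by (rule lie_algebra_bm)
  define p where "p = CHAR('k)"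
  have p: "prime p" "p > 2"
    using assms prime_CHAR_semidom[where ?'a = 'k] by (simp_all add: p_def)
  then have odd: "odd p"
    using prime_odd_nat by blast
  obtain m where m: "p = Suc (Suc m)"
    using p(2) by (metis Suc_lessE numeral_2_eq_2)
  have odd_m: "odd m"
    using odd m by simp
  have choose0: "of_nat (p choose i) = (0 :: 'k)" if "0 < i" "i < p" for i
    using that p dvd_choose_prime[of i p] by (simp add: of_nat_eq_0_iff_char_dvd p_def)
  have of_nat_ne: "of_nat i \<noteq> (0 :: 'k)" if "0 < i" "i < p" for i
    using that by (auto simp: of_nat_eq_0_iff_char_dvd p_def dest: dvd_imp_le)
  have of_nat_p: "of_nat (Suc m) = (-1 :: 'k)"
  proof -
    have "of_nat (Suc (Suc m)) = (0 :: 'k)"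
      unfolding m[symmetric] p_def by (rule of_nat_CHAR)
    then show ?thesis
      by (simp add: add.commute eq_neg_iff_add_eq_0)
  qed
  have coeff: "inverse (of_nat (Suc i)) * of_nat (m choose i) = (- of_nat (Suc m choose Suc i) :: 'k)"
    if "i \<le> m" for i
  proof -
    have "of_nat (Suc i) * of_nat (Suc m choose Suc i) = (- of_nat (m choose i) :: 'k)"
      using arg_cong[OF Suc_times_binomial[of i m], of "of_nat :: nat \<Rightarrow> 'k"]
      unfolding of_nat_mult of_nat_p by simp
    then have "of_nat (m choose i) = - (of_nat (Suc i) * of_nat (Suc m choose Suc i) :: 'k)"
      by (metis minus_minus)
    then show ?thesis
      using of_nat_ne[of "Suc i"] that m by (simp del: of_nat_Suc binomial_Suc_Suc)
  qed
  have "bm_pmap (x + y) = bm_pmap x + bm_pmap y + (\<Sum>i = 1..<p. jacobson i x y)"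
    for x y :: "'k triple"
  proof -
    obtain a b c a' b' c' where x: "x = (a, b, c)" and y: "y = (a', b', c')"
      by (metis prod.exhaust)
    define S where "S = (\<Sum>i\<le>m. of_nat (Suc m choose Suc i) * (a ^ i * a' ^ (m - i)))"
    have jac: "jacobson (Suc i) x y =
        (0, - (of_nat (Suc m choose Suc i) * (a ^ i * a' ^ (m - i))) * (a' * b - a * b'),
            - (of_nat (Suc m choose Suc i) * (a ^ i * a' ^ (m - i))) * (- (a * c' - a' * c)))"
      if "i \<le> m" for i
    proof -
      have "CHAR('k) - 1 = Suc m"
        using m by (simp add: p_def)
      then show ?thesis
        using odd_m unfolding jacobson_def x y
        by (simp add: bm_ad_coeff coeff[OF that] mult.assoc[symmetric]
            del: of_nat_Suc binomial_Suc_Suc ad_coeff.simps)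
    qed
    have "(\<Sum>i = 1..<p. jacobson i x y) = (\<Sum>i\<le>m. jacobson (Suc i) x y)"
      unfolding m by (simp only: One_nat_def sum.shift_bounds_Suc_ivl
          atLeast0LessThan lessThan_Suc_atMost)
    also have "\<dots> = (\<Sum>i\<le>m.
        (0, - (of_nat (Suc m choose Suc i) * (a ^ i * a' ^ (m - i))) * (a' * b - a * b'),
            - (of_nat (Suc m choose Suc i) * (a ^ i * a' ^ (m - i))) * (- (a * c' - a' * c))))"
      by (intro sum.cong refl jac) simp
    also have "\<dots> = (0, - S * (a' * b - a * b'), - S * (- (a * c' - a' * c)))"
      unfolding S_def by (simp only: sum_prod sum_distrib_right sum_negf[symmetric]) simp
    finally have sum: "(\<Sum>i = 1..<p. jacobson i x y) =
        (0, - S * (a' * b - a * b'), - S * (- (a * c' - a' * c)))" .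
    have binom: "(a + a') ^ Suc m = (\<Sum>i\<le>Suc m. of_nat (Suc m choose i) * a ^ i * a' ^ (Suc m - i))"
      by (rule binomial_ring)
    have aS: "a * S = (a + a') ^ Suc m - a' ^ Suc m"
      unfolding binom sum.atMost_Suc_shift S_def sum_distrib_left
      by (simp add: algebra_simps del: binomial_Suc_Suc)
    have neg: "of_nat (Suc m choose Suc i) = (- of_nat (Suc m choose i) :: 'k)" if "i \<le> m" for i
      using choose0[of "Suc i"] that unfolding m binomial_Suc_Suc[of "Suc m"]
      by (simp add: eq_neg_iff_add_eq_0 add.commute del: binomial_Suc_Suc)
    have "a' * S = (\<Sum>i\<le>m. - (of_nat (Suc m choose i) * a ^ i * a' ^ (Suc m - i)))"
      unfolding S_def sum_distrib_left
      by (intro sum.cong refl) (simp add: neg Suc_diff_le del: binomial_Suc_Suc)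
    then have a'S: "a' * S = - ((a + a') ^ Suc m - a ^ Suc m)"
      unfolding binom sum.atMost_Suc by (simp add: sum_negf)
    have frob: "(a + a') ^ p = a ^ p + a' ^ p"
      by (rule freshmans_dream) (use p in \<open>simp_all add: p_def\<close>)
    have lin: "(a + a') ^ Suc m * (u + u') = a ^ Suc m * u + a' ^ Suc m * u' + - S * (a' * u - a * u')"
      for u u'
    proof -
      have "- S * (a' * u - a * u') = - (a' * S) * u + (a * S) * u'"
        by (simp add: algebra_simps)
      then show ?thesis
        unfolding aS a'S by (simp add: algebra_simps)
    qed
    have "CHAR('k) - 1 = Suc m" "CHAR('k) = p"
      using m by (simp_all add: p_def)
    then show ?thesis
      unfolding sum unfolding x y using frob lin[of b b'] lin[of c c']
      by (simp add: algebra_simps del: power_Suc)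
  qed
  moreover have "bm_bracket (bm_pmap x) y = (bm_bracket x ^^ p) y" for x y :: "'k triple"
  proof -
    obtain a b c a' b' c' where x: "x = (a, b, c)" and y: "y = (a', b', c')"
      by (metis prod.exhaust)
    have "(bm_bracket x ^^ p) y = (0, a ^ Suc m * (a * b' - a' * b), - (a ^ Suc m * (a * c' - a' * c)))"
      unfolding x y m bm_ad_power using odd_m by (simp del: power_Suc)
    moreover have "CHAR('k) - 1 = Suc m" "CHAR('k) = Suc (Suc m)"
      using m by (simp_all add: p_def)
    ultimately show ?thesis
      unfolding x y by (simp add: algebra_simps)
  qed
  moreover have "bm_pmap (bm_scale r x) = bm_scale (r ^ p) (bm_pmap x)" for r and x :: "'k triple"
  proof -
    have "r ^ p = r ^ (CHAR('k) - 1) * r"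
      using p power_minus_mult[of p r] by (simp add: p_def)
    then show ?thesis
      by (cases x) (simp add: power_mult_distrib p_def mult_ac)
  qed
  moreover have "\<exists>B. finite_dimensional_vector_space bm_scale (B :: 'k triple set)"
  proof -
    let ?B = "{(1, 0, 0), (0, 1, 0), (0, 0, 1)} :: 'k triple set"
    have "v \<in> span ?B" for v
    proof -
      obtain a b c where v: "v = (a, b, c)"
        by (metis prod.exhaust)
      have "v = bm_scale a (1, 0, 0) + (bm_scale b (0, 1, 0) + bm_scale c (0, 0, 1))"
        by (simp add: v)
      also have "\<dots> \<in> span ?B"
        by (intro span_add span_scale span_base) auto
      finally show ?thesis .
    qed
    then have "span ?B = UNIV"
      by blast
    moreover obtain B where "B \<subseteq> ?B" "independent B" "?B \<subseteq> span B"
      by (rule maximal_independent_subset)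
    ultimately have "finite B" "independent B" "span B = UNIV"
      using span_mono[of ?B "span B"] finite_subset[of B ?B] by (auto simp: span_span)
    then show ?thesis
      by (intro exI[of _ B]) (unfold_locales)
  qed
  ultimately show ?thesis
    by unfold_locales (use p in \<open>simp_all add: p_def\<close>)
qed

text \<open>The standard Borel subalgebra has a basis \<open>t, x\<close> with the usual relations.\<close>

lemma mat_power_diag2:
  "mat_power (vector [vector [a, 0], vector [0, d]] :: 'k::comm_ring_1^2^2) n
    = vector [vector [a ^ n, 0], vector [0, d ^ n]]"
  by (induction n)
    (simp_all add: mat_power_def mat_def matrix_matrix_mult_def vec_eq_iff forall_2 sum_2)

lemma borel_sl2_relations:
  assumes "CHAR('k::field) > 2"
  defines "t \<equiv> vector [vector [1 / 2, 0], vector [0, - 1 / 2]] :: 'k^2^2"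
    and "x \<equiv> vector [vector [0, 1], vector [0, 0]] :: 'k^2^2"
  shows "carr borel_sl2 = {ladd borel_sl2 (lscale borel_sl2 a t) (lscale borel_sl2 b x) | a b. True}"
    and "lbracket borel_sl2 t x = x"
    and "lpmap borel_sl2 t = t"
    and "lpmap borel_sl2 x = 0"
proof -
  have p: "prime CHAR('k)"
    using assms(1) by (intro prime_CHAR_semidom) simp
  have two: "(2 :: 'k) \<noteq> 0"
    using of_nat_eq_0_iff_char_dvd[of 2, where ?'a = 'k] assms(1) by (auto dest: dvd_imp_le)
  have "(2 :: 'k) ^ CHAR('k) = (1 + 1) ^ CHAR('k)"
    by simp
  also have "\<dots> = 2"
    unfolding freshmans_dream[OF p refl] by simp
  finally have half: "(1 / 2 :: 'k) ^ CHAR('k) = 1 / 2"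
    by (simp add: power_divide)
  have "(- 1 / 2 :: 'k) ^ CHAR('k) = - 1 / 2"
    using minus_power_prime_CHAR[OF refl p, of "1 / 2"] half by simp
  then show "lpmap borel_sl2 t = t"
    using half
    by (simp only: borel_sl2_def matrix_lie_struct_def lie_struct.simps t_def mat_power_diag2)
  have "x ** (x ** B) = 0" for B
    by (simp add: x_def matrix_matrix_mult_def vec_eq_iff forall_2 sum_2)
  moreover obtain n where "CHAR('k) = Suc (Suc n)"
    using assms(1) by (metis Suc_lessE numeral_2_eq_2)
  ultimately show "lpmap borel_sl2 x = 0"
    by (simp add: borel_sl2_def matrix_lie_struct_def mat_power_def)
  show "lbracket borel_sl2 t x = x"
    using two by (simp add: borel_sl2_def matrix_lie_struct_def t_def x_def matrix_matrix_mult_def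
        vec_eq_iff forall_2 sum_2 field_simps)
  have "trace A = 0 \<and> A$2$1 = 0 \<longleftrightarrow> (\<exists>a b. A = (\<chi> i j. a * t$i$j) + (\<chi> i j. b * x$i$j))" for A
  proof
    assume "trace A = 0 \<and> A$2$1 = 0"
    then have "A = (\<chi> i j. (2 * A$1$1) * t$i$j) + (\<chi> i j. A$1$2 * x$i$j)"
      using two by (simp add: trace_def sum_2 vec_eq_iff forall_2 t_def x_def eq_neg_iff_add_eq_0 add.commute)
    then show "\<exists>a b. A = (\<chi> i j. a * t$i$j) + (\<chi> i j. b * x$i$j)"
      by blast
  next
    assume "\<exists>a b. A = (\<chi> i j. a * t$i$j) + (\<chi> i j. b * x$i$j)"
    then show "trace A = 0 \<and> A$2$1 = 0"
      by (auto simp: trace_def sum_2 t_def x_def)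
  qed
  then show "carr borel_sl2 =
      {ladd borel_sl2 (lscale borel_sl2 a t) (lscale borel_sl2 b x) | a b. True}"
    by (auto simp: borel_sl2_def matrix_lie_struct_def)
qed

end

theory Submission
  imports Defs
begin

text \<open>
  Let \<open>T\<close> be a self-centralizing torus. For \<open>t \<in> T\<close> the endomorphism \<open>ad t\<close> is annihilated by a
  separable \<open>p\<close>-polynomial, so the algebra is the sum of \<open>T\<close> and its root spaces. A root vector becomes
  \<open>p\<close>-nilpotent after subtracting an element of \<open>T\<close> with the same \<open>p\<close>-th power, and \<open>p\<close>-rank 1 then
  says that linearly independent root vectors never commute. Hence \<open>a + b\<close> is a root or zero for
  distinct roots \<open>a\<close>, \<open>b\<close>, and the theorem reduces to excluding that both \<open>a\<close> and \<open>2a\<close> are roots: in that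
  case all nonzero multiples of \<open>a\<close> are roots and opposite root vectors span copies of \<open>sl(2)\<close>, as in
  the Witt algebra. Conjugating such an \<open>sl(2)\<close> by a truncated exponential \<open>exp(s ad f)\<close>, for a
  suitable \<open>s\<close>, makes two independent eigenvectors commute; both are nilpotent modulo central
  elements, a contradiction. So the roots are \<open>a\<close> and possibly \<open>-a\<close>, with one-dimensional root spaces,
  and the center is the kernel of \<open>a\<close> on \<open>T\<close>.
\<close>

section \<open>Commuting elements and the nullcone\<close>

text \<open>Root vectors for \<open>T\<close> alone give no contradiction when a and 2a are roots.
  In the Witt algebra with the torus spanned by (1+x) d/dx, the root vectors (1+x)^(i+1) d/dx of
  distinct weights never commute and opposite ones have nonzero bracket, although the p-rank exceeds
  1. The commuting pair has to be sought off the root spaces. For an sl(2)-triple e, h, f with f of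
  weight -a, and b of weight -2a, one gets [e, b] = c f with no control over c. A genuine
  automorphism exp(s ad f) would carry this relation along unchanged. The series cut off at p is not
  an automorphism: its failure contributes a multiple of s^p f, and over an algebraically closed
  field some s cancels c. What survives the truncation is the conjugation of ad h, which is enough
  to control eigenvectors and centralizer of h + 2 s f. Characteristic 3 is different in kind: there
  2a = -a, so sl(2) itself has both a and 2a as roots.\<close>

context lie_algebra
begin

lemma bracket_sum_right: "bracket x (sum f A) = (\<Sum>i\<in>A. bracket x (f i))"
proof (induction A rule: infinite_finite_induct)
  case (infinite A)
  then show ?case
    using bracket_scale_right[of x 0 0] by simp
next
  case empty
  then show ?case
    using bracket_scale_right[of x 0 0] by simp
qed (simp add: bracket_add_right)

lemma ad_pow_linear:
  shows ad_pow_add: "(bracket x ^^ n) (y + z) = (bracket x ^^ n) y + (bracket x ^^ n) z"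
    and ad_pow_scale: "(bracket x ^^ n) (scale c y) = scale c ((bracket x ^^ n) y)"
  by (induction n) (simp_all add: bracket_add_right bracket_scale_right)

lemma ad_pow_zero: "(bracket x ^^ n) 0 = 0"
  using ad_pow_scale[where c = 0 and y = 0 and x = x and n = n] by simp

lemma ad_pow_sum: "(bracket x ^^ n) (sum f A) = (\<Sum>i\<in>A. (bracket x ^^ n) (f i))"
  by (induction A rule: infinite_finite_induct) (simp_all add: ad_pow_zero ad_pow_add)

lemma ad_pow_eq_0_mono:
  assumes "(bracket x ^^ m) y = 0" "m \<le> n"
  shows "(bracket x ^^ n) y = 0"
proof -
  have "(bracket x ^^ n) y = (bracket x ^^ (n - m)) ((bracket x ^^ m) y)"
    using assms(2) by (simp flip: funpow_add comp_apply[of "bracket x ^^ _"])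
  then show ?thesis
    by (simp add: assms(1) ad_pow_zero)
qed

end

context restricted_lie_algebra
begin

lemma bracket_bracket_left: "bracket (bracket x y) z = bracket x (bracket y z) - bracket y (bracket x z)"
proof -
  have "bracket (bracket x y) z = - bracket z (bracket x y)"
    by (rule bracket_skew)
  also have "\<dots> = bracket x (bracket y z) + bracket y (bracket z x)"
    using jacobi[of x y z] by (metis add_eq_0_iff minus_minus)
  also have "bracket y (bracket z x) = - bracket y (bracket x z)"
    by (metis bracket_skew bracket_minus_right)
  finally show ?thesis
    by simp
qed

lemma bracket_derivation: "bracket x (bracket y z) = bracket (bracket x y) z + bracket y (bracket x z)"
  by (simp add: bracket_bracket_left)

lemma pmap_0: "pmap 0 = 0"
  using pmap_scale[of 0 0] CHAR_pos by (simp add: power_0_left)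

text \<open>The Jacobson terms are coefficients of ad(T x + y)^(p-1)(x), and p - 1 >= 1, so the
  innermost bracket already vanishes.\<close>

lemma pmap_add_commuting:
  assumes "bracket x y = 0"
  shows "pmap (x + y) = pmap x + pmap y"
proof -
  have yx: "bracket y x = 0"
    using assms bracket_skew[of y x] by simp
  have ad: "ad_coeff x y (Suc n) j = 0" for n j
    by (induction n arbitrary: j) (auto simp: yx bracket_self split: nat.split)
  obtain n where "CHAR('k) - 1 = Suc n"
    using CHAR_gt_1 gr0_conv_Suc[of "CHAR('k) - 1"] by auto
  then have "jacobson i x y = 0" for i
    unfolding jacobson_def by (simp only: ad scale_zero_right)
  then show ?thesis
    using pmap_add[of x y] by simp
qed

lemma pmap_minus: "pmap (- x) = - pmap x"
  using pmap_add_commuting[of x "- x"] by (simp add: pmap_0 bracket_minus_right bracket_self eq_neg_iff_add_eq_0 add.commute)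

lemma bracket_pmap_self: "bracket (pmap x) x = 0"
proof -
  obtain n where "CHAR('k) = Suc n"
    using CHAR_pos gr0_conv_Suc by blast
  then show ?thesis
    unfolding ad_pmap by (simp add: funpow_Suc_right bracket_self ad_pow_zero del: funpow.simps)
qed

lemma centralizer_subspace: "subspace (centralizer S)"
  by (simp add: subspace_def centralizer_def bracket_add_left bracket_scale_left)

lemma centralizer_bracket:
  "\<lbrakk>x \<in> centralizer S; y \<in> centralizer S\<rbrakk> \<Longrightarrow> bracket x y \<in> centralizer S"
  by (simp add: centralizer_def bracket_bracket_left)

lemma centralizer_pmap: "x \<in> centralizer S \<Longrightarrow> pmap x \<in> centralizer S"
  unfolding centralizer_def mem_Collect_eq ad_pmap
proof
  fix s assume "\<forall>s\<in>S. bracket x s = 0" "s \<in> S"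
  then have "(bracket x ^^ 1) s = 0"
    by simp
  then show "(bracket x ^^ CHAR('k)) s = 0"
    by (rule ad_pow_eq_0_mono) (use CHAR_pos in linarith)
qed

end

context fin_dim_restricted_lie_algebra
begin

text \<open>Otherwise \<open>x\<close> and \<open>y\<close> span a plane in the nullcone: on
  commuting elements the p-map is additive, so it vanishes on all their combinations. This is how
  the upper bound in \<open>p_rank = 1\<close> is used throughout.\<close>

lemma p_rank_1_commuting_nullcone:
  assumes rank: "p_rank = 1"
    and x: "x \<in> nullcone" and y: "y \<in> nullcone" and xy: "bracket x y = 0"
  shows "x = 0 \<or> y = 0 \<or> (\<exists>c. y = scale c x)"
proof (rule ccontr)
  assume neg: "\<not> ?thesis"
  have ind: "independent {y, x}"
    using neg by (intro independent_insertI) (auto simp: span_singleton independent_empty)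
  have "y \<noteq> x"
    using neg scale_one by metis
  then have dim: "dim (span {y, x}) = 2"
    using dim_span_eq_card_independent[OF ind] by simp
  have yx: "bracket y x = 0"
    using xy bracket_skew[of y x] by simp
  have elt: "\<exists>c d. z = scale c y + scale d x" if "z \<in> span {y, x}" for z
  proof -
    from that obtain c d where "z - scale c y = scale d x"
      by (auto simp: span_insert span_singleton)
    then have "z = scale c y + scale d x"
      by (simp add: algebra_simps)
    then show ?thesis
      by blast
  qed
  have "span {y, x} \<in> elementary_subalgebras 2"
    unfolding elementary_subalgebras_def mem_Collect_eq
  proof (intro conjI dim subspace_span)
    show "abelian (span {y, x})"
      by (auto simp: abelian_def dest!: elt
          simp: bracket_add_left bracket_add_right bracket_scale_left bracket_scale_right xy yx bracket_self)
    show "span {y, x} \<subseteq> nullcone"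
    proof
      fix z assume "z \<in> span {y, x}"
      then obtain c d where z: "z = scale c y + scale d x"
        using elt by blast
      have "pmap z = pmap (scale c y) + pmap (scale d x)"
        unfolding z by (rule pmap_add_commuting) (simp add: bracket_scale_left bracket_scale_right yx)
      then show "z \<in> nullcone"
        using x y by (simp add: nullcone_def pmap_scale)
    qed
  qed
  then have "2 \<le> p_rank"
    unfolding p_rank_def by (intro Max_ge p_rank_well_defined) auto
  with rank show False
    by simp
qed

text \<open>The lower bound in \<open>p_rank = 1\<close>. It serves to exclude that the whole
  algebra is a torus.\<close>

lemma p_rank_1_obtains_nilpotent:
  assumes "p_rank = 1"
  obtains x where "x \<noteq> 0" "pmap x = 0"
proof -
  have "p_rank \<in> {r. elementary_subalgebras r \<noteq> {}}"
    unfolding p_rank_def by (intro Max_in p_rank_well_defined)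
  then obtain E where E: "subspace E" "dim E = 1" "E \<subseteq> nullcone"
    using assms by (auto simp: elementary_subalgebras_def)
  have "\<not> E \<subseteq> {0}"
  proof
    assume "E \<subseteq> {0}"
    then have "span E = span {}"
      using span_mono[of E "{0}"] span_zero[of E] by auto
    then show False
      using E(2) span_eq_dim[of E "{}"] dim_eq_card_independent[OF independent_empty] by simp
  qed
  then show thesis
    using that E(3) by (auto simp: nullcone_def)
qed

end

section \<open>Root space decomposition\<close>

context lie_algebra
begin

definition ad_poly :: "'g \<Rightarrow> 'k poly \<Rightarrow> 'g \<Rightarrow> 'g" where
  "ad_poly t q x = (\<Sum>i\<le>degree q. scale (coeff q i) ((bracket t ^^ i) x))"

lemma ad_poly_altdef:
  assumes "degree q \<le> n"
  shows "ad_poly t q x = (\<Sum>i\<le>n. scale (coeff q i) ((bracket t ^^ i) x))"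
  unfolding ad_poly_def using assms by (intro sum.mono_neutral_left) (auto simp: coeff_eq_0)

lemma ad_poly_0: "ad_poly t 0 x = 0"
  by (simp add: ad_poly_def)

lemma ad_poly_add: "ad_poly t (q + r) x = ad_poly t q x + ad_poly t r x"
  using degree_add_le[of q "max (degree q) (degree r)" r]
  by (simp add: ad_poly_altdef[where n = "max (degree q) (degree r)"] scale_left_distrib sum.distrib)

lemma ad_poly_sum: "ad_poly t (sum q A) x = (\<Sum>i\<in>A. ad_poly t (q i) x)"
  by (induction A rule: infinite_finite_induct) (simp_all add: ad_poly_0 ad_poly_add)

lemma ad_poly_monom: "ad_poly t (monom c n) x = scale c ((bracket t ^^ n) x)"
proof -
  have "ad_poly t (monom c n) x = (\<Sum>i\<le>n. if i = n then scale c ((bracket t ^^ i) x) else 0)"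
    unfolding ad_poly_altdef[OF degree_monom_le] by (intro sum.cong refl) simp
  then show ?thesis
    by simp
qed

text \<open>Splitting off one root drives the induction on the degree in
  \<open>ad_poly_eigenvectors\<close>.\<close>

lemma ad_poly_linear_factor:
  "ad_poly t ([:- c, 1:] * q) x = ad_poly t q (bracket t x - scale c x)"
proof -
  define n where "n = degree q"
  have deg: "degree ([:- c, 1:] * q) \<le> Suc n"
    using degree_mult_le[of "[:- c, 1:]" q] by (simp add: n_def)
  have q0: "coeff q (Suc n) = 0"
    by (simp add: n_def coeff_eq_0)
  have ad: "(bracket t ^^ i) (bracket t x - scale c x) =
      (bracket t ^^ Suc i) x - scale c ((bracket t ^^ i) x)" for i
    using ad_pow_add[of i t "bracket t x" "scale (- c) x"] ad_pow_scale[of i t "- c" x]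
    by (simp add: funpow_swap1)
  have "ad_poly t ([:- c, 1:] * q) x =
      (\<Sum>i\<le>Suc n. scale (- c * coeff q i + coeff (pCons 0 q) i) ((bracket t ^^ i) x))"
    unfolding ad_poly_altdef[OF deg] by (intro sum.cong refl) simp
  also have "\<dots> = (\<Sum>i\<le>Suc n. scale (- c * coeff q i) ((bracket t ^^ i) x))
      + (\<Sum>i\<le>Suc n. scale (coeff (pCons 0 q) i) ((bracket t ^^ i) x))"
    by (simp only: scale_left_distrib sum.distrib)
  also have "(\<Sum>i\<le>Suc n. scale (- c * coeff q i) ((bracket t ^^ i) x)) =
      (\<Sum>i\<le>n. scale (- c * coeff q i) ((bracket t ^^ i) x))"
    by (simp add: q0)
  also have "(\<Sum>i\<le>Suc n. scale (coeff (pCons 0 q) i) ((bracket t ^^ i) x)) =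
      (\<Sum>i\<le>n. scale (coeff q i) ((bracket t ^^ Suc i) x))"
    unfolding sum.atMost_Suc_shift by simp
  finally show ?thesis
    unfolding ad_poly_def ad n_def[symmetric]
    by (simp add: scale_right_diff_distrib sum_subtractf sum_negf mult.commute)
qed

end

locale generically_toral_lie_algebra = fin_dim_restricted_lie_algebra scale bracket pmap
  for scale :: "'k::alg_closed_field \<Rightarrow> 'g::ab_group_add \<Rightarrow> 'g" and bracket pmap +
  fixes T :: "'g set"
  assumes torus: "torus T" and self_centralizing: "self_centralizing T"
begin

text \<open>Diagonalizability by a separable polynomial, on an invariant subspace \<open>U\<close>
  so that it can be applied to joint eigenspaces. Write q = (X - l) r. By induction (ad t - l) x is
  a sum of eigenvectors with eigenvalues m different from l. There ad t - l is invertible, with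
  inverse 1/(m - l), so (ad t - l) x = (ad t - l) z for some z in their span, and x - z is an
  eigenvector for l.\<close>

lemma ad_poly_eigenvectors:
  assumes "q \<noteq> 0" "\<And>m. poly q m = 0 \<Longrightarrow> poly (pderiv q) m \<noteq> 0"
    and U: "subspace U" "\<And>u. u \<in> U \<Longrightarrow> bracket t u \<in> U"
    and "x \<in> U" "ad_poly t q x = 0"
  shows "x \<in> span {v \<in> U. \<exists>m. poly q m = 0 \<and> bracket t v = scale m v}"
  using assms(1,2,5,6)
proof (induction "degree q" arbitrary: q x)
  case 0
  then obtain c where "q = [:c:]"
    by (metis degree_eq_zeroE)
  with 0 have "x = 0"
    by (simp add: ad_poly_def)
  then show ?case
    by (simp add: span_zero)
next
  case (Suc n)
  define A where "A = (\<lambda>q. {v \<in> U. \<exists>m. poly q m = 0 \<and> bracket t v = scale m v})"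
  from Suc.hyps(2) have "degree q > 0"
    by simp
  then obtain l where l: "poly q l = 0"
    using alg_closed_imp_poly_has_root by blast
  then obtain r where q: "q = [:- l, 1:] * r"
    unfolding poly_eq_0_iff_dvd by (auto elim: dvdE)
  have r0: "r \<noteq> 0"
    using Suc.prems(1) q by auto
  have deg: "n = degree r"
    using Suc.hyps(2) degree_mult_eq[of "[:- l, 1:]" r] r0 unfolding q by simp
  have pd: "poly (pderiv q) m = poly r m + (m - l) * poly (pderiv r) m" for m
    unfolding q pderiv_mult by (simp add: pderiv_pCons algebra_simps)
  have rl: "poly r l \<noteq> 0"
    using Suc.prems(2)[OF l] pd[of l] by simp
  have simple: "poly (pderiv r) m \<noteq> 0" if "poly r m = 0" for m
    using Suc.prems(2)[of m] that pd[of m] by (auto simp: q)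
  define y where "y = bracket t x - scale l x"
  have "y \<in> U"
    unfolding y_def using U Suc.prems(3) by (intro subspace_diff subspace_scale)
  moreover have "ad_poly t r y = 0"
    using Suc.prems(4) unfolding q ad_poly_linear_factor y_def .
  ultimately have "y \<in> span (A r)"
    unfolding A_def by (intro Suc.hyps(1) deg r0 simple)
  then have "\<exists>z \<in> span (A r). bracket t z - scale l z = y"
  proof (induction rule: span_induct_alt)
    case base
    then show ?case
      using bracket_scale_right[of t 0 0] by (intro bexI[of _ 0]) (auto simp: span_zero)
  next
    case (step c v w)
    then obtain m z where m: "poly r m = 0" "bracket t v = scale m v"
      and z: "z \<in> span (A r)" "bracket t z - scale l z = w"
      by (auto simp: A_def)
    have "m \<noteq> l"
      using m(1) rl by auto
    then have "c * m / (m - l) - l * (c / (m - l)) = c"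
      by (simp add: diff_divide_distrib[symmetric] mult.commute right_diff_distrib[symmetric])
    then have "bracket t (scale (c / (m - l)) v + z) - scale l (scale (c / (m - l)) v + z) = scale c v + w"
      unfolding z(2)[symmetric]
      by (simp add: bracket_add_right bracket_scale_right m(2) scale_right_distrib algebra_simps
          flip: scale_left_diff_distrib)
    moreover have "scale (c / (m - l)) v + z \<in> span (A r)"
      using span_scale[OF span_base[OF step(1)]] z(1) by (rule span_add)
    ultimately show ?case
      by blast
  qed
  then obtain z where z: "z \<in> span (A r)" "bracket t z - scale l z = y"
    by blast
  have AU: "span (A r) \<subseteq> U"
    using span_minimal[OF _ U(1), of "A r"] by (auto simp: A_def)
  have "bracket t (x - z) = scale l (x - z)"
    using z(2) unfolding y_def bracket_diff_right by (simp add: algebra_simps)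
  then have "x - z \<in> A q"
    using l Suc.prems(3) z(1) AU U(1) unfolding A_def by (blast intro: subspace_diff)
  moreover have "A r \<subseteq> A q"
    by (auto simp: A_def q)
  then have "z \<in> span (A q)"
    using z(1) span_mono by blast
  ultimately have "(x - z) + z \<in> span (A q)"
    using span_add span_base by blast
  then show ?case
    by (simp add: A_def)
qed

lemma T_subspace: "subspace T"
  and T_pmap: "t \<in> T \<Longrightarrow> pmap t \<in> T"
  and T_bracket: "s \<in> T \<Longrightarrow> t \<in> T \<Longrightarrow> bracket s t = 0"
  and T_pmap_inj: "inj_on pmap T"
  and T_pmap_image: "pmap ` T = T"
  using torus
  by (auto simp: torus_def p_subalgebra_def lie_subalgebra_def abelian_def bij_betw_def)

lemma centralizer_T: "centralizer T = T"
  using self_centralizing by (simp add: self_centralizing_def)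

lemma T_pmap_sum:
  assumes "\<And>i. i \<in> A \<Longrightarrow> f i \<in> T"
  shows "pmap (sum f A) = (\<Sum>i\<in>A. pmap (f i))"
  using assms
proof (induction A rule: infinite_finite_induct)
  case (insert i A)
  then have "bracket (f i) (sum f A) = 0"
    by (intro T_bracket subspace_sum T_subspace) auto
  with insert show ?case
    by (simp add: pmap_add_commuting)
qed (simp_all add: pmap_0)

text \<open>The relation is one of families: if \<open>f\<close> repeats a value, the set of values
  may be independent, and the relation is f i - f j = 0.\<close>

lemma linear_relation_exists:
  fixes f :: "nat \<Rightarrow> 'g"
  obtains n c where "\<exists>i\<le>n. c i \<noteq> 0" "(\<Sum>i\<le>n. scale (c i) (f i)) = 0"
proof -
  obtain B where "finite_dimensional_vector_space scale B"
    using fin_dim by blast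
  then interpret fd: finite_dimensional_vector_space scale B .
  define d where "d = dim (UNIV :: 'g set)"
  show thesis
  proof (cases "inj_on f {..d}")
    case True
    then have "card (f ` {..d}) = Suc d"
      by (simp add: card_image)
    then have "dependent (f ` {..d})"
      using fd.independent_card_le_dim[of "f ` {..d}" UNIV] unfolding d_def by fastforce
    then obtain u where u: "\<exists>v\<in>f ` {..d}. u v \<noteq> 0" "(\<Sum>v\<in>f ` {..d}. scale (u v) v) = 0"
      using dependent_finite[of "f ` {..d}"] by auto
    then have "(\<Sum>i\<le>d. scale (u (f i)) (f i)) = 0"
      by (simp add: sum.reindex[OF True])
    with u(1) show thesis
      by (intro that[of d "\<lambda>i. u (f i)"]) auto
  next
    case False
    then obtain i j where ij: "i < j" "j \<le> d" "f i = f j"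
      unfolding inj_on_def by (metis atMost_iff linorder_neqE_nat)
    define c :: "nat \<Rightarrow> 'k" where "c = (\<lambda>k. (if k = i then 1 else 0) - (if k = j then 1 else 0))"
    have *: "scale (if b then 1 else 0) v = (if b then v else 0)" for b v
      by simp
    have "(\<Sum>k\<le>d. scale (c k) (f k)) = 0"
      unfolding c_def scale_left_diff_distrib sum_subtractf * using ij by simp
    moreover have "c j \<noteq> 0"
      using ij by (simp add: c_def)
    ultimately show thesis
      using that ij(2) by blast
  qed
qed

text \<open>
  Extracting \<open>p\<close>-th roots from a relation between the \<open>t\<^bsup>[p]^i\<^esup>\<close> that starts with \<open>c\<^sub>1 t\<^bsup>[p]\<^esup>\<close> yields
  a shorter one, because the \<open>p\<close>-map is injective on \<open>T\<close>. So a shortest relation has \<open>c\<^sub>0 \<noteq> 0\<close>, and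
  the corresponding \<open>p\<close>-polynomial, which annihilates \<open>ad t\<close>, is separable.
\<close>

lemma torus_separable_polynomial:
  assumes t: "t \<in> T"
  obtains q where "q \<noteq> 0" "\<And>m. poly (pderiv q) m \<noteq> 0" "\<And>x. ad_poly t q x = 0"
proof -
  define p where "p = CHAR('k)"
  have p0: "p > 0"
    using CHAR_pos by (simp add: p_def)
  define \<tau> where "\<tau> = (\<lambda>i. (pmap ^^ i) t)"
  have \<tau>T: "\<tau> i \<in> T" for i
    unfolding \<tau>_def by (induction i) (auto intro: t T_pmap)
  define R where "R = (\<lambda>n. \<exists>c. (\<exists>i\<le>n. c i \<noteq> 0) \<and> (\<Sum>i\<le>n. scale (c i) (\<tau> i)) = 0)"
  define n where "n = (LEAST n. R n)"
  have "\<exists>n. R n"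
    using linear_relation_exists[of \<tau>] unfolding R_def by metis
  then have "R n"
    unfolding n_def by (rule LeastI_ex)
  then obtain c where c: "\<exists>i\<le>n. c i \<noteq> 0" "(\<Sum>i\<le>n. scale (c i) (\<tau> i)) = 0"
    unfolding R_def by blast
  have c0: "c 0 \<noteq> 0"
  proof
    assume c0: "c 0 = 0"
    then obtain m where m: "n = Suc m"
      using c(1) by (metis le_zero_eq not0_implies_Suc)
    have "\<forall>i. \<exists>d. d ^ p = c (Suc i)"
      using nth_root_exists[OF p0] by blast
    then obtain d where d: "\<And>i. d i ^ p = c (Suc i)"
      by metis
    define w where "w = (\<Sum>i\<le>m. scale (d i) (\<tau> i))"
    have sT: "scale (d i) (\<tau> i) \<in> T" for i
      by (intro subspace_scale T_subspace \<tau>T)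
    have "pmap w = (\<Sum>i\<le>m. scale (c (Suc i)) (\<tau> (Suc i)))"
      unfolding w_def using T_pmap_sum[of "{..m}" "\<lambda>i. scale (d i) (\<tau> i)", OF sT]
      by (simp add: pmap_scale d[unfolded p_def] \<tau>_def)
    also have "\<dots> = (\<Sum>i\<le>n. scale (c i) (\<tau> i))"
      unfolding m sum.atMost_Suc_shift by (simp add: c0)
    finally have "pmap w = pmap 0"
      using c(2) pmap_0 by simp
    moreover have "w \<in> T" "0 \<in> T"
      unfolding w_def by (auto intro: subspace_sum T_subspace sT subspace_0)
    ultimately have "w = 0"
      using T_pmap_inj by (meson inj_onD)
    moreover obtain i where "i \<le> n" "c i \<noteq> 0"
      using c(1) by blast
    then have "\<exists>i\<le>m. d i \<noteq> 0"
      using c0 d p0 m by (metis Suc_le_mono power_0_left not_gr_zero not0_implies_Suc)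
    ultimately have "R m"
      unfolding R_def w_def by blast
    then have "n \<le> m"
      unfolding n_def by (rule Least_le)
    then show False
      using m by simp
  qed
  define q where "q = (\<Sum>i\<le>n. monom (c i) (p ^ i))"
  have "pderiv q = (\<Sum>i\<le>n. monom (of_nat (p ^ i) * c i) (p ^ i - 1))"
    unfolding q_def using higher_pderiv_sum[of 1 "\<lambda>i. monom (c i) (p ^ i)" "{..n}"] by (simp add: pderiv_monom)
  \<comment> \<open>p^i vanishes in the field for i > 0, so only the linear term of the p-polynomial
    has a nonzero derivative.\<close>
  also have "\<dots> = (\<Sum>i\<le>n. if i = 0 then [:c 0:] else 0)"
    by (intro sum.cong refl) (auto simp: p_def monom_0)
  also have "\<dots> = [:c 0:]"
    by simp
  finally have pd: "pderiv q = [:c 0:]" .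
  have ad: "bracket (\<tau> i) = bracket t ^^ (p ^ i)" for i
  proof (induction i)
    case 0
    show ?case
      by (simp add: \<tau>_def)
  next
    case (Suc i)
    have "bracket (\<tau> (Suc i)) = bracket (\<tau> i) ^^ p"
      unfolding p_def by (rule ext) (simp add: \<tau>_def ad_pmap)
    then show ?case
      unfolding Suc funpow_mult by (simp add: mult.commute)
  qed
  have bracket_sum_left: "bracket (sum f A) x = (\<Sum>i\<in>A. bracket (f i) x)" for f :: "nat \<Rightarrow> 'g" and A x
    by (induction A rule: infinite_finite_induct) (simp_all add: bracket_add_left)
  have "ad_poly t q x = bracket (\<Sum>i\<le>n. scale (c i) (\<tau> i)) x" for x
    unfolding q_def ad_poly_sum ad_poly_monom bracket_sum_left bracket_scale_left ad ..
  then have "ad_poly t q x = 0" for x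
    by (simp add: c(2))
  moreover have "q \<noteq> 0"
    using pd c0 by auto
  ultimately show thesis
    using that[of q] by (simp add: pd c0)
qed

text \<open>Since \<open>T\<close> is abelian, ad t preserves each joint eigenspace \<open>U\<close>
  of \<open>B\<close>, and its separable polynomial splits \<open>U\<close> further.\<close>

lemma simultaneous_eigenvectors:
  assumes "finite B" "B \<subseteq> T"
  shows "x \<in> span {v. \<forall>t\<in>B. \<exists>m. bracket t v = scale m v}"
  using assms
proof (induction B arbitrary: x rule: finite_induct)
  case empty
  then show ?case
    by simp
next
  case (insert t B)
  define A where "A = (\<lambda>B. {v. \<forall>t\<in>B. \<exists>m. bracket t v = scale m v})"
  obtain q where q: "q \<noteq> 0" "\<And>m. poly (pderiv q) m \<noteq> 0" "\<And>x. ad_poly t q x = 0"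
    using torus_separable_polynomial insert.prems by blast
  have "v \<in> span (A (insert t B))" if "v \<in> A B" for v
  proof -
    from that have "\<forall>s. \<exists>m. s \<in> B \<longrightarrow> bracket s v = scale m v"
      by (auto simp: A_def)
    then obtain m where m: "\<And>s. s \<in> B \<Longrightarrow> bracket s v = scale (m s) v"
      by metis
    define U where "U = {u. \<forall>s\<in>B. bracket s u = scale (m s) u}"
    have "subspace U"
      by (auto simp: U_def subspace_def bracket_add_right bracket_scale_right scale_right_distrib mult.commute)
    moreover have "bracket t u \<in> U" if "u \<in> U" for u
    proof -
      have "bracket s (bracket t u) = scale (m s) (bracket t u)" if "s \<in> B" for s
        using \<open>u \<in> U\<close> that insert.prems T_bracket[of s t] unfolding bracket_derivation[of s t u] U_def
        by (auto simp: bracket_scale_right)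
      then show ?thesis
        by (simp add: U_def)
    qed
    moreover have "v \<in> U"
      by (simp add: U_def m)
    ultimately have "v \<in> span {v \<in> U. \<exists>m. poly q m = 0 \<and> bracket t v = scale m v}"
      using q by (intro ad_poly_eigenvectors) auto
    also have "\<dots> \<subseteq> span (A (insert t B))"
      by (intro span_mono) (auto simp: A_def U_def)
    finally show ?thesis .
  qed
  then have "span (A B) \<subseteq> span (A (insert t B))"
    by (intro span_minimal subspace_span) auto
  then show ?case
    using insert.IH[of x] insert.prems unfolding A_def by blast
qed

text \<open>Weights are plain functions, compared on \<open>T\<close>. Their linearity on
  \<open>T\<close> and compatibility with the p-map are derived from a nonzero weight vector in
  \<open>weight_add\<close>, \<open>weight_scale\<close> and \<open>weight_pmap\<close>.\<close>

definition weight_space :: "('g \<Rightarrow> 'k) \<Rightarrow> 'g set" where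
  "weight_space a = {x. \<forall>t\<in>T. bracket t x = scale (a t) x}"

lemma weight_space_decomposition: "x \<in> span (\<Union>a. weight_space a)"
proof -
  obtain B where "finite_dimensional_vector_space scale B"
    using fin_dim by blast
  then interpret fd: finite_dimensional_vector_space scale B .
  obtain D where D: "D \<subseteq> T" "finite D" "T \<subseteq> span D"
    using fd.basis_subspace_exists[OF T_subspace] by (metis order_refl)
  have "{v. \<forall>t\<in>D. \<exists>m. bracket t v = scale m v} \<subseteq> (\<Union>a. weight_space a)"
  proof
    fix v assume v: "v \<in> {v. \<forall>t\<in>D. \<exists>m. bracket t v = scale m v}"
    have "subspace {t. \<exists>m. bracket t v = scale m v}"
      unfolding subspace_def
      by (auto simp: bracket_add_left bracket_scale_left
          simp flip: scale_left_distrib intro: exI[of _ 0])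
    then have "span D \<subseteq> {t. \<exists>m. bracket t v = scale m v}"
      using v by (intro span_minimal) auto
    then have "\<forall>t\<in>T. \<exists>m. bracket t v = scale m v"
      using D(3) by auto
    then obtain a where "\<forall>t\<in>T. bracket t v = scale (a t) v"
      by metis
    then show "v \<in> (\<Union>a. weight_space a)"
      by (auto simp: weight_space_def)
  qed
  then show ?thesis
    using simultaneous_eigenvectors[OF D(2,1), of x] span_mono by blast
qed

end

section \<open>Root vectors and root strings\<close>

locale toral_p_rank_1 = generically_toral_lie_algebra scale bracket pmap T
  for scale :: "'k::alg_closed_field \<Rightarrow> 'g::ab_group_add \<Rightarrow> 'g" and bracket pmap T +
  assumes CHAR_ge_5: "CHAR('k) \<ge> 5" and p_rank: "p_rank = 1"
begin

lemma of_nat_neq_0: "0 < i \<Longrightarrow> i < CHAR('k) \<Longrightarrow> of_nat i \<noteq> (0 :: 'k)"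
  by (auto simp: of_nat_eq_0_iff_char_dvd dest: dvd_imp_le)

lemma numeral_neq_0: "(2 :: 'k) \<noteq> 0" "(3 :: 'k) \<noteq> 0" "(4 :: 'k) \<noteq> 0" "(6 :: 'k) \<noteq> 0"
proof -
  show "(2 :: 'k) \<noteq> 0" "(3 :: 'k) \<noteq> 0" "(4 :: 'k) \<noteq> 0"
    using of_nat_neq_0[of 2] of_nat_neq_0[of 3] of_nat_neq_0[of 4] CHAR_ge_5 by simp_all
  \<comment> \<open>In characteristic 5 the number 6 is not below p, so it is treated as a
    product.\<close>
  then have "(2 :: 'k) * 3 \<noteq> 0"
    unfolding mult_eq_0_iff by blast
  then show "(6 :: 'k) \<noteq> 0"
    by simp
qed

lemma weight_space_subspace: "subspace (weight_space a)"
  by (auto simp: weight_space_def subspace_def bracket_add_right bracket_scale_right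
      scale_right_distrib mult.commute)

lemma weight_spaceD:
  assumes "x \<in> weight_space a" "t \<in> T"
  shows "bracket t x = scale (a t) x" "bracket x t = scale (- a t) x"
  using assms bracket_skew[of x t] by (auto simp: weight_space_def)

lemma weight_space_cong: "(\<And>t. t \<in> T \<Longrightarrow> a t = b t) \<Longrightarrow> weight_space a = weight_space b"
  by (auto simp: weight_space_def)

text \<open>Self-centralization enters here: brackets of opposite root vectors thereby land in
  \<open>T\<close>, where \<open>a\<close> can be evaluated on them.\<close>

lemma weight_space_0: "weight_space (\<lambda>t. 0) = T"
proof -
  have "bracket t x = 0 \<longleftrightarrow> bracket x t = 0" for x t
    using bracket_skew[of x t] by simp
  then have "weight_space (\<lambda>t. 0) = centralizer T"
    by (auto simp: weight_space_def centralizer_def)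
  then show ?thesis
    by (simp add: centralizer_T)
qed

lemma weight_space_bracket:
  assumes "x \<in> weight_space a" "y \<in> weight_space b"
  shows "bracket x y \<in> weight_space (\<lambda>t. a t + b t)"
  using assms unfolding weight_space_def
  by (auto simp: bracket_derivation[of _ x y] bracket_scale_left bracket_scale_right scale_left_distrib)

lemma weight_space_bracketI:
  assumes "x \<in> weight_space a" "y \<in> weight_space b" "\<And>t. t \<in> T \<Longrightarrow> c t = a t + b t"
  shows "bracket x y \<in> weight_space c"
  using weight_space_bracket[OF assms(1,2)] weight_space_cong[of c "\<lambda>t. a t + b t"] assms(3) by simp

lemma weight_space_bracket_T:
  assumes "x \<in> weight_space a" "y \<in> weight_space b" "\<And>t. t \<in> T \<Longrightarrow> a t + b t = 0"
  shows "bracket x y \<in> T"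
  using weight_space_bracketI[OF assms(1,2), of "\<lambda>t. 0"] assms(3) weight_space_0 by simp

lemma weight_add:
  assumes "x \<in> weight_space a" "x \<noteq> 0" "s \<in> T" "t \<in> T"
  shows "a (s + t) = a s + a t"
proof -
  have "scale (a (s + t)) x = scale (a s + a t) x"
    using assms weight_spaceD(1)[OF assms(1)] subspace_add[OF T_subspace assms(3,4)]
    by (metis bracket_add_left scale_left_distrib)
  then show ?thesis
    using assms(2) by simp
qed

lemma weight_scale:
  assumes "x \<in> weight_space a" "x \<noteq> 0" "t \<in> T"
  shows "a (scale c t) = c * a t"
proof -
  have "scale (a (scale c t)) x = scale (c * a t) x"
    using assms weight_spaceD(1)[OF assms(1)] subspace_scale[OF T_subspace assms(3)]
    by (metis bracket_scale_left scale_scale)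
  then show ?thesis
    using assms(2) by simp
qed

lemma weight_pmap:
  assumes "x \<in> weight_space a" "x \<noteq> 0" "t \<in> T"
  shows "a (pmap t) = a t ^ CHAR('k)"
proof -
  have "(bracket t ^^ n) x = scale (a t ^ n) x" for n
    by (induction n) (use assms in \<open>simp_all add: bracket_scale_right weight_spaceD mult.commute\<close>)
  then have "scale (a (pmap t)) x = scale (a t ^ CHAR('k)) x"
    using weight_spaceD(1)[OF assms(1) T_pmap[OF assms(3)]] by (metis ad_pmap)
  then show ?thesis
    using assms(2) scale_right_imp_eq by blast
qed

text \<open>ad x maps \<open>T\<close> into the line through \<open>x\<close>, so (ad x)^2, and with
  it ad(x^[p]), kills \<open>T\<close>.\<close>

lemma weight_vector_pmap_T:
  assumes "x \<in> weight_space a"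
  shows "pmap x \<in> T"
proof -
  have "bracket (pmap x) t = 0" if "t \<in> T" for t
    unfolding ad_pmap
  proof (rule ad_pow_eq_0_mono)
    show "(bracket x ^^ 2) t = 0"
      using weight_spaceD(2)[OF assms that]
      by (simp add: numeral_2_eq_2 bracket_minus_right bracket_scale_right bracket_self)
  qed (use CHAR_ge_5 in simp)
  then have "pmap x \<in> centralizer T"
    by (simp add: centralizer_def)
  then show ?thesis
    by (simp add: centralizer_T)
qed

lemma weight_vector_not_T:
  assumes "x \<in> weight_space a" "x \<noteq> 0" "t \<in> T" "a t \<noteq> 0"
  shows "x \<notin> T"
  using assms weight_spaceD(1)[OF assms(1,3)] T_bracket[OF assms(3), of x] by auto

lemma weight_vector_pmap_root:
  assumes "x \<in> weight_space a" "x \<noteq> 0"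
  shows "a (pmap x) = 0"
  using weight_spaceD(1)[OF assms(1) weight_vector_pmap_T[OF assms(1)]] bracket_pmap_self[of x] assms(2)
  by simp

lemma commuting_root_vectors_toral_part:
  assumes x: "x \<in> weight_space a" "x \<noteq> 0" and y: "y \<in> weight_space b" "y \<noteq> 0"
    and xy: "bracket x y = 0"
  obtains s where "s \<in> T" "pmap s = pmap x" "a s = 0" "b s = 0"
proof -
  obtain s where s: "s \<in> T" "pmap s = pmap x"
    using weight_vector_pmap_T[OF x(1)] T_pmap_image by (metis imageE)
  have "a s ^ CHAR('k) = 0"
    using weight_pmap[OF x s(1)] weight_vector_pmap_root[OF x] s(2) by simp
  moreover have "bracket (pmap x) y = 0"
    unfolding ad_pmap by (rule ad_pow_eq_0_mono[of 1]) (use CHAR_ge_5 xy in simp_all)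
  then have "b (pmap x) = 0"
    using weight_spaceD(1)[OF y(1) weight_vector_pmap_T[OF x(1)]] y(2) by simp
  then have "b s ^ CHAR('k) = 0"
    using weight_pmap[OF y s(1)] s(2) by simp
  ultimately show thesis
    using that s by simp
qed

text \<open>
  A root vector \<open>x\<close> differs from a \<open>p\<close>-nilpotent element by some \<open>s \<in> T\<close> with \<open>s\<^bsup>[p]\<^esup> = x\<^bsup>[p]\<^esup>\<close>.
  If \<open>y\<close> commutes with \<open>x\<close>, it commutes with \<open>x\<^bsup>[p]\<^esup>\<close> and hence with \<open>s\<close>.
\<close>

lemma commuting_root_vectors_dependent:
  assumes x: "x \<in> weight_space a" "x \<noteq> 0" "t \<in> T" "a t \<noteq> 0"
    and y: "y \<in> weight_space b" "y \<noteq> 0" "t' \<in> T" "b t' \<noteq> 0"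
    and xy: "bracket x y = 0"
  shows "\<exists>c. y = scale c x"
proof -
  have yx: "bracket y x = 0"
    using xy bracket_skew[of y x] by simp
  obtain s where s: "s \<in> T" "pmap s = pmap x" "a s = 0" "b s = 0"
    using commuting_root_vectors_toral_part[OF x(1,2) y(1,2) xy] .
  obtain s' where s': "s' \<in> T" "pmap s' = pmap y" "b s' = 0" "a s' = 0"
    using commuting_root_vectors_toral_part[OF y(1,2) x(1,2) yx] .
  have sx: "bracket x s = 0" "bracket x s' = 0" "bracket s y = 0" "bracket y s' = 0"
    using weight_spaceD[OF x(1)] weight_spaceD[OF y(1)] s s' by simp_all
  have "pmap (x - s) = 0" "pmap (y - s') = 0"
    using pmap_add_commuting[of x "- s"] pmap_add_commuting[of y "- s'"] sx s s'
    by (simp_all add: bracket_minus_right pmap_minus)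
  moreover have "bracket (x - s) (y - s') = 0"
    using sx T_bracket[OF s(1) s'(1)] by (simp add: bracket_diff_left bracket_diff_right xy)
  moreover have "x - s \<noteq> 0" "y - s' \<noteq> 0"
    using weight_vector_not_T[OF x] weight_vector_not_T[OF y] s(1) s'(1) by auto
  ultimately obtain c where "y - s' = scale c (x - s)"
    using p_rank_1_commuting_nullcone[OF p_rank, of "x - s" "y - s'"] by (auto simp: nullcone_def)
  then have "y - scale c x = s' - scale c s"
    by (simp add: scale_right_diff_distrib algebra_simps)
  then have "y - scale c x \<in> T"
    using s(1) s'(1) by (simp add: T_subspace subspace_diff subspace_scale)
  \<comment> \<open>ad t' kills this element of \<open>T\<close> but multiplies \<open>y\<close> by
    the nonzero scalar \<open>b t'\<close>, so \<open>y\<close> can be solved for.\<close>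
  then have "bracket t' (y - scale c x) = 0"
    by (rule T_bracket[OF y(3)])
  then have "scale (b t') y = scale (c * a t') x"
    using weight_spaceD(1)[OF x(1) y(3)] weight_spaceD(1)[OF y(1,3)]
    by (simp add: bracket_diff_right bracket_scale_right)
  then have "scale (inverse (b t')) (scale (b t') y) = scale (inverse (b t')) (scale (c * a t') x)"
    by simp
  then show ?thesis
    using y(4) by auto
qed

lemma root_vectors_bracket_neq_0:
  assumes x: "x \<in> weight_space a" "x \<noteq> 0" "t \<in> T" "a t \<noteq> 0"
    and y: "y \<in> weight_space b" "y \<noteq> 0" "t' \<in> T" "b t' \<noteq> 0"
    and ab: "u \<in> T" "a u \<noteq> b u"
  shows "bracket x y \<noteq> 0"
proof
  assume "bracket x y = 0"
  then obtain c where c: "y = scale c x"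
    using commuting_root_vectors_dependent[OF x y] by blast
  then have "scale (b u) y = scale (a u) y"
    using weight_spaceD(1)[OF x(1) ab(1)] weight_spaceD(1)[OF y(1) ab(1)]
    by (metis bracket_scale_right scale_left_commute)
  with ab(2) y(2) show False
    using scale_right_imp_eq by metis
qed

text \<open>A step from weight j a with 2 <= j < p is nonzero because j a is neither 0 nor a. The
  last admissible step reaches weight p a = 0 and gives a nonzero element of
  \<open>T\<close>.\<close>

lemma root_string:
  assumes x: "x \<in> weight_space a" "x \<noteq> 0" "t \<in> T" "a t \<noteq> 0"
    and w: "w \<in> weight_space (\<lambda>t. of_nat i * a t)" "w \<noteq> 0"
    and "2 \<le> i" "i + m \<le> CHAR('k)"
  shows "(bracket x ^^ m) w \<in> weight_space (\<lambda>t. of_nat (i + m) * a t) \<and> (bracket x ^^ m) w \<noteq> 0"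
  using assms(8)
proof (induction m)
  case 0
  show ?case
    using w by simp
next
  case (Suc m)
  define v where "v = (bracket x ^^ m) w"
  have v: "v \<in> weight_space (\<lambda>t. of_nat (i + m) * a t)" "v \<noteq> 0"
    using Suc unfolding v_def by simp_all
  have "of_nat (i + m) \<noteq> (0 :: 'k)" "of_nat (i + m - 1) \<noteq> (0 :: 'k)"
    using Suc.prems assms(7) by (intro of_nat_neq_0; linarith)+
  moreover from this have "of_nat (i + m) \<noteq> (1 :: 'k)"
    using assms(7) of_nat_diff[of 1 "i + m", where ?'a = 'k] by (auto simp del: of_nat_add)
  ultimately have "bracket x v \<noteq> 0"
    using x by (intro root_vectors_bracket_neq_0[OF x v x(3) _ x(3)]) (auto simp del: of_nat_add)
  moreover have "bracket x v \<in> weight_space (\<lambda>t. of_nat (i + Suc m) * a t)"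
    by (rule weight_space_bracketI[OF x(1) v(1)]) (simp add: algebra_simps)
  ultimately show ?case
    by (simp add: v_def)
qed

end

section \<open>The situation to be refuted: both a and 2a are roots\<close>

locale double_root = toral_p_rank_1 scale bracket pmap T
  for scale :: "'k::alg_closed_field \<Rightarrow> 'g::ab_group_add \<Rightarrow> 'g" and bracket pmap T +
  fixes a :: "'g \<Rightarrow> 'k" and x0 w0 u0 :: 'g
  assumes u0: "u0 \<in> T" "a u0 \<noteq> 0"
    and x0: "x0 \<in> weight_space a" "x0 \<noteq> 0"
    and w0: "w0 \<in> weight_space (\<lambda>t. 2 * a t)" "w0 \<noteq> 0"
begin

text \<open>The part of \<open>T\<close> that acts trivially on all weight spaces for multiples of
  \<open>a\<close>. The argument takes place in the centralizer of \<open>Z\<close>, where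
  \<open>Z\<close> behaves like a center.\<close>

definition Z :: "'g set" where
  "Z = {z \<in> T. a z = 0}"

lemma Z_weight_space:
  assumes "z \<in> Z" "y \<in> weight_space (\<lambda>t. c * a t)"
  shows "bracket z y = 0"
  using assms weight_spaceD(1)[OF assms(2), of z] by (simp add: Z_def)

lemma commuting_root_vectors_string:
  assumes xy: "bracket x y \<in> Z" and x: "x \<in> weight_space a" and w: "w \<in> weight_space (\<lambda>t. of_nat i * a t)"
  shows "bracket y ((bracket x ^^ m) w) = (bracket x ^^ m) (bracket y w)"
proof (induction m)
  case (Suc m)
  have "(bracket x ^^ m) w \<in> weight_space (\<lambda>t. of_nat (i + m) * a t)"
  proof (induction m)
    case (Suc m)
    show ?case
      unfolding funpow.simps comp_apply by (rule weight_space_bracketI[OF x Suc]) (simp add: algebra_simps)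
  qed (use w in simp)
  from Z_weight_space[OF xy this] have "bracket y (bracket x ((bracket x ^^ m) w)) = bracket x (bracket y ((bracket x ^^ m) w))"
    by (simp add: bracket_bracket_left)
  with Suc show ?case
    by simp
qed simp

text \<open>
  Otherwise \<open>ad x\<close> and \<open>ad y\<close> commute on all root spaces to multiples of \<open>a\<close>. Then \<open>y = (ad x)\<^bsup>p-3\<^esup> w\<close>
  for some \<open>w\<close> of weight \<open>2a\<close>, and applying \<open>ad x ad y\<close> gives \<open>0\<close> although root strings do not vanish.
\<close>

lemma opposite_root_vectors:
  assumes x: "x \<in> weight_space a" "x \<noteq> 0" and y: "y \<in> weight_space (\<lambda>t. - a t)" "y \<noteq> 0"
  shows "a (bracket x y) \<noteq> 0"
proof
  assume a0: "a (bracket x y) = 0"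
  \<comment> \<open>n = p - 3 is the number of steps of ad x from weight 2a to weight -a.\<close>
  obtain n where n: "CHAR('k) = Suc (Suc (Suc n))" "n \<ge> 2"
    using CHAR_ge_5 that[of "CHAR('k) - 3"] by simp
  have nz: "- a u0 \<noteq> 0"
    using u0 by simp
  have "bracket x y \<in> T"
    by (rule weight_space_bracket_T[OF x(1) y(1)]) simp
  with a0 have xyZ: "bracket x y \<in> Z"
    by (simp add: Z_def)
  note comm = commuting_root_vectors_string[OF xyZ x(1)]
  have nonzero: "bracket x (bracket y w) \<in> weight_space (\<lambda>t. of_nat 2 * a t) \<and> bracket x (bracket y w) \<noteq> 0"
    if w: "w \<in> weight_space (\<lambda>t. of_nat 2 * a t)" "w \<noteq> 0" for w
  proof -
    have xw: "bracket x w \<in> weight_space (\<lambda>t. of_nat 3 * a t)" "bracket x w \<noteq> 0"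
      using root_string[OF x u0 w, of 1] CHAR_ge_5 by simp_all
    have "- a u0 \<noteq> of_nat 3 * a u0"
    proof
      assume "- a u0 = of_nat 3 * a u0"
      then have "4 * a u0 = 0"
        by (simp add: algebra_simps neg_eq_iff_add_eq_0)
      then show False
        using u0(2) numeral_neq_0 by simp
    qed
    moreover have "of_nat 3 * a u0 \<noteq> 0"
      using u0(2) numeral_neq_0 by simp
    ultimately have "bracket y (bracket x w) \<noteq> 0"
      using root_vectors_bracket_neq_0[OF y u0(1) nz xw u0(1) _ u0(1)] by simp
    moreover have "bracket y (bracket x w) \<in> weight_space (\<lambda>t. of_nat 2 * a t)"
      by (rule weight_space_bracketI[OF y(1) xw(1)]) (simp add: algebra_simps)
    ultimately show ?thesis
      using comm[OF w(1), of 1] by simp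
  qed
  have w0': "w0 \<in> weight_space (\<lambda>t. of_nat 2 * a t)"
    using w0(1) by simp
  define t where "t = (bracket x ^^ Suc n) w0"
  have "t \<in> weight_space (\<lambda>t. of_nat (2 + Suc n) * a t)"
    using root_string[OF x u0 w0' w0(2), of "Suc n"] n unfolding t_def by simp
  moreover have "2 + Suc n = CHAR('k)"
    using n by simp
  ultimately have t: "t \<in> T"
    using weight_space_0 by (simp only: of_nat_CHAR mult_zero_left)
  define w1 where "w1 = bracket x (bracket y w0)"
  have w1: "w1 \<in> weight_space (\<lambda>t. of_nat 2 * a t)" "w1 \<noteq> 0"
    using nonzero[OF w0' w0(2)] unfolding w1_def by simp_all
  have "(bracket x ^^ n) w1 \<noteq> 0"
    using root_string[OF x u0 w1, of n] n by simp
  \<comment> \<open>Moving ad y past the string turns it into the bracket of \<open>y\<close> with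
    \<open>t\<close>, a toral element, hence into a multiple of \<open>y\<close>. Nonvanishing of
    the left side gives \<open>a t\<close> nonzero, and rescaling \<open>w1\<close> by it hits
    \<open>y\<close> exactly.\<close>
  moreover have w1y: "(bracket x ^^ n) w1 = scale (a t) y"
  proof -
    have "(bracket x ^^ n) w1 = (bracket x ^^ Suc n) (bracket y w0)"
      by (simp add: w1_def funpow_Suc_right del: funpow.simps)
    also have "\<dots> = bracket y t"
      unfolding t_def by (rule comm[OF w0', symmetric])
    also have "\<dots> = scale (a t) y"
      using weight_spaceD(2)[OF y(1) t] by simp
    finally show ?thesis .
  qed
  ultimately have at: "a t \<noteq> 0"
    by auto
  define w2 where "w2 = scale (inverse (a t)) w1"
  have w2: "w2 \<in> weight_space (\<lambda>t. of_nat 2 * a t)" "w2 \<noteq> 0"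
    using w1 at unfolding w2_def by (simp_all add: subspace_scale weight_space_subspace)
  have w2y: "(bracket x ^^ n) w2 = y"
    using at by (simp add: w2_def ad_pow_scale w1y)
  have "(bracket x ^^ n) (bracket x (bracket y w2)) = (bracket x ^^ Suc n) (bracket y w2)"
    by (simp add: funpow_Suc_right del: funpow.simps)
  also have "\<dots> = bracket x (bracket y ((bracket x ^^ n) w2))"
    by (simp add: comm[OF w2(1)])
  also have "\<dots> = 0"
    by (simp add: w2y bracket_self)
  finally show False
    using root_string[OF x u0 conjunct1[OF nonzero[OF w2]] conjunct2[OF nonzero[OF w2]], of n] n by simp
qed

end

section \<open>Truncated exponentials\<close>

context restricted_lie_algebra
begin

lemma fact_neq_0: "n < CHAR('k) \<Longrightarrow> of_nat (fact n) \<noteq> (0 :: 'k)"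
proof (induction n)
  case (Suc n)
  then have "of_nat (Suc n) \<noteq> (0 :: 'k)"
    by (auto simp: of_nat_eq_0_iff_char_dvd simp del: of_nat_Suc dest: dvd_imp_le)
  with Suc show ?case
    by (simp only: fact_Suc of_nat_mult of_nat_id mult_eq_0_iff) simp
qed simp

definition ecoeff :: "'k \<Rightarrow> nat \<Rightarrow> 'k" where
  "ecoeff s n = s ^ n / of_nat (fact n)"

lemma ecoeff_Suc:
  assumes "Suc n < CHAR('k)"
  shows "of_nat (Suc n) * ecoeff s (Suc n) = s * ecoeff s n"
  using fact_neq_0[OF assms] unfolding ecoeff_def fact_Suc of_nat_mult
  by (simp add: of_nat_mult field_simps del: of_nat_Suc)

definition texp :: "'g \<Rightarrow> 'k \<Rightarrow> 'g \<Rightarrow> 'g" where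
  "texp f s y = (\<Sum>k<CHAR('k). scale (ecoeff s k) ((bracket f ^^ k) y))"

lemma texp_scale: "texp f s (scale c y) = scale c (texp f s y)"
  by (simp add: texp_def ad_pow_scale scale_sum_right mult.commute)

lemma texp_diff: "texp f s (y - z) = texp f s y - texp f s z"
  using ad_pow_add[of _ f y "scale (-1) z"] ad_pow_scale[of _ f "-1" z]
  by (simp add: texp_def sum_subtractf scale_right_diff_distrib)

lemma texp_add: "texp f s (y + z) = texp f s y + texp f s z"
  by (simp add: texp_def ad_pow_add sum.distrib scale_right_distrib)

lemma texp_bracket: "bracket f (texp f s y) = texp f s (bracket f y)"
  by (simp add: texp_def bracket_sum_right bracket_scale_right funpow_swap1)

text \<open>On such vectors \<open>texp f s\<close> is the identity plus a nilpotent operator.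
  Concretely, if (ad f)^(n+1) y = 0, then applying (ad f)^n to \<open>texp f s y = 0\<close> leaves
  only the constant term, so (ad f)^n y = 0.\<close>

lemma texp_eq_0_imp:
  assumes "texp f s y = 0" and nil: "(bracket f ^^ CHAR('k)) y = 0"
  shows "y = 0"
proof -
  have "(bracket f ^^ (CHAR('k) - m)) y = 0" for m
  proof (induction m)
    case (Suc m)
    show ?case
    proof (cases "m < CHAR('k)")
      case True
      define n where "n = CHAR('k) - Suc m"
      have n: "CHAR('k) - m = Suc n"
        using True by (simp add: n_def)
      have pow: "(bracket f ^^ n) ((bracket f ^^ k) y) = (if k = 0 then (bracket f ^^ n) y else 0)" for k
        using ad_pow_eq_0_mono[OF Suc[unfolded n], of "n + k"] by (auto simp: funpow_add)
      have "0 = (bracket f ^^ n) (texp f s y)"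
        by (simp add: assms(1) ad_pow_zero)
      also have "\<dots> = (\<Sum>k<CHAR('k). if k = 0 then (bracket f ^^ n) y else 0)"
        unfolding texp_def ad_pow_sum ad_pow_scale pow by (intro sum.cong) (auto simp: ecoeff_def)
      also have "\<dots> = (bracket f ^^ n) y"
        using CHAR_pos by simp
      finally show ?thesis
        by (simp add: n_def)
    qed (use Suc in simp)
  qed (use nil in simp)
  from this[of "CHAR('k)"] show ?thesis
    by simp
qed

lemma weight_ad_pow:
  assumes hf: "bracket h f = scale (- 2) f"
  shows "bracket h ((bracket f ^^ k) y) = (bracket f ^^ k) (bracket h y) - scale (2 * of_nat k) ((bracket f ^^ k) y)"
proof (induction k)
  case (Suc k)
  have "bracket h ((bracket f ^^ Suc k) y) =
      scale (- 2) ((bracket f ^^ Suc k) y) + bracket f (bracket h ((bracket f ^^ k) y))"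
    using bracket_derivation[of h f "(bracket f ^^ k) y"] by (simp add: hf bracket_scale_left bracket_minus_left)
  then show ?case
    unfolding Suc by (simp add: bracket_diff_right bracket_scale_right scale_left_distrib algebra_simps)
qed simp

text \<open>
  \<open>texp f s\<close> is the truncated exponential of \<open>s ad f\<close>. In spite of the truncation it conjugates \<open>ad h\<close>
  into the action of \<open>exp(s ad f)(h) = h + 2s f\<close> on vectors killed by \<open>(ad f)\<^sup>p\<close>.
\<close>

lemma texp_conjugates:
  assumes hf: "bracket h f = scale (- 2) f" and nil: "(bracket f ^^ CHAR('k)) y = 0"
  shows "bracket (h + scale (2 * s) f) (texp f s y) = texp f s (bracket h y)"
proof -
  define H where "H = h + scale (2 * s) f"
  have H: "bracket H ((bracket f ^^ k) y) = (bracket f ^^ k) (bracket h y)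
      - scale (2 * of_nat k) ((bracket f ^^ k) y) + scale (2 * s) ((bracket f ^^ Suc k) y)" for k
    by (simp add: H_def bracket_add_left bracket_scale_left weight_ad_pow[OF hf])
  \<comment> \<open>Every truncation leaves a single boundary term, which the next summand cancels.
    At n = p - 1 this term contains (ad f)^p y = 0.\<close>
  have "bracket H (\<Sum>k\<le>n. scale (ecoeff s k) ((bracket f ^^ k) y)) =
      (\<Sum>k\<le>n. scale (ecoeff s k) ((bracket f ^^ k) (bracket h y)))
      + scale (2 * s * ecoeff s n) ((bracket f ^^ Suc n) y)" if "n < CHAR('k)" for n
    using that
  proof (induction n)
    case 0
    show ?case
      using H[of 0] by (simp add: ecoeff_def)
  next
    case (Suc n)
    have c: "2 * s * ecoeff s n = ecoeff s (Suc n) * (2 * of_nat (Suc n))"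
      using ecoeff_Suc[OF Suc.prems, of s] by (simp add: algebra_simps del: of_nat_Suc)
    show ?case
      using Suc unfolding sum.atMost_Suc bracket_add_right bracket_scale_right H c
      by (simp add: scale_right_diff_distrib scale_right_distrib algebra_simps del: of_nat_Suc)
  qed
  from this[of "CHAR('k) - 1"] show ?thesis
    using CHAR_pos nil unfolding texp_def H_def[symmetric] lessThan_Suc_atMost[symmetric] by simp
qed

end

section \<open>The centralizer of h + 2 s f\<close>

context double_root
begin

text \<open>(ad f)^p = ad(f^[p]), and f^[p] is an element of \<open>T\<close> on which
  \<open>a\<close> vanishes. This supplies the nilpotency that the truncated exponential
  requires.\<close>

lemma nil_centralizer_Z:
  assumes f: "f \<in> weight_space (\<lambda>t. - a t)" "f \<noteq> 0" and y: "y \<in> centralizer Z"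
  shows "(bracket f ^^ CHAR('k)) y = 0"
proof -
  have "pmap f \<in> Z"
    using weight_vector_pmap_T[OF f(1)] weight_vector_pmap_root[OF f] by (simp add: Z_def)
  then show ?thesis
    using y bracket_skew[of "pmap f" y] by (simp add: centralizer_def ad_pmap)
qed

lemma weight_space_centralizer_Z:
  assumes "y \<in> weight_space (\<lambda>t. c * a t)"
  shows "y \<in> centralizer Z"
proof -
  have "bracket y z = 0" if "z \<in> Z" for z
    using Z_weight_space[OF that assms] bracket_skew[of y z] by simp
  then show ?thesis
    by (simp add: centralizer_def)
qed

lemma Z_pmap_root:
  assumes "z \<in> Z"
  obtains s where "s \<in> Z" "pmap s = z"
proof -
  obtain s where s: "s \<in> T" "pmap s = z"
    using assms T_pmap_image by (metis (no_types, lifting) Z_def imageE mem_Collect_eq)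
  have "a s ^ CHAR('k) = 0"
    using weight_pmap[OF x0 s(1)] s(2) assms by (simp add: Z_def)
  then show thesis
    using that[of s] s by (simp add: Z_def)
qed

text \<open>E = \<open>texp f (- s)\<close> carries ad(h + 2 s f) back to ad h. Hence E y commutes
  with h and with \<open>Z\<close>, so with \<open>T\<close> = Z + k h, and self-centralization puts
  E y into \<open>T\<close>. Writing E y = z + m h = E (z + m (h + 2 s f)), injectivity of E on the
  centralizer of \<open>Z\<close> finishes.\<close>

lemma centralizer_conjugate_torus:
  assumes f: "f \<in> weight_space (\<lambda>t. - a t)" "f \<noteq> 0" and h: "h \<in> T" "a h = 2"
    and y: "y \<in> centralizer Z" "bracket (h + scale (2 * s) f) y = 0"
  shows "\<exists>z\<in>Z. \<exists>m. y = z + scale m (h + scale (2 * s) f)"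
proof -
  define H where "H = h + scale (2 * s) f"
  have hf: "bracket h f = scale (- 2) f"
    using weight_spaceD(1)[OF f(1) h(1)] h(2) by simp
  have fZ: "f \<in> centralizer Z"
    by (rule weight_space_centralizer_Z[where c = "-1"]) (use f in simp)
  have hZ: "h \<in> centralizer Z"
    using T_bracket[OF h(1)] by (simp add: centralizer_def Z_def)
  note nil = nil_centralizer_Z[OF f]
  define E where "E = texp f (- s)"
  have E_diff: "E (u - v) = E u - E v" for u v
    unfolding E_def by (rule texp_diff)
  have "bracket (h + scale (2 * - s) f) (E y) = E (bracket h y)"
    unfolding E_def by (rule texp_conjugates[OF hf nil[OF y(1)]])
  then have "bracket h (E y) = E (bracket h y) + scale (2 * s) (bracket f (E y))"
    by (simp add: bracket_diff_left bracket_scale_left algebra_simps)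
  also have "\<dots> = E (bracket H y)"
    by (simp add: H_def E_def texp_bracket bracket_add_left bracket_scale_left texp_add texp_scale)
  also have "\<dots> = 0"
    using y(2) texp_scale[of f "- s" 0 0] by (simp add: H_def E_def)
  finally have hE: "bracket h (E y) = 0" .
  have "(bracket f ^^ k) y \<in> centralizer Z" for k
    by (induction k) (use y(1) fZ in \<open>auto intro: centralizer_bracket\<close>)
  then have EZ: "E y \<in> centralizer Z"
    unfolding E_def texp_def by (intro subspace_sum subspace_scale centralizer_subspace)
  have T_split: "t - scale (a t / 2) h \<in> Z" if "t \<in> T" for t
  proof -
    have "a (t - scale (a t / 2) h) = a t + - (a t / 2) * a h"
      using weight_add[OF x0 that, of "scale (- (a t / 2)) h"] weight_scale[OF x0 h(1), of "- (a t / 2)"] h(1)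
      by (simp add: T_subspace subspace_neg subspace_scale)
    then have "a (t - scale (a t / 2) h) = 0"
      using numeral_neq_0 by (simp add: h(2))
    then show ?thesis
      using that h(1) by (simp add: Z_def T_subspace subspace_diff subspace_scale)
  qed
  have "bracket (E y) t = 0" if "t \<in> T" for t
  proof -
    have "bracket (E y) (t - scale (a t / 2) h) = 0"
      using T_split[OF that] EZ by (auto simp: centralizer_def)
    moreover have "bracket (E y) h = 0"
      using hE bracket_skew[of "E y" h] by simp
    ultimately show ?thesis
      by (simp add: bracket_diff_right bracket_scale_right)
  qed
  then have "E y \<in> centralizer T"
    by (simp add: centralizer_def)
  then have Ey: "E y \<in> T"
    by (simp add: centralizer_T)
  define m where "m = a (E y) / 2"
  define z where "z = E y - scale m h"
  have z: "z \<in> Z"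
    unfolding z_def m_def by (rule T_split[OF Ey])
  have fz: "bracket f z = 0"
    using fZ z by (auto simp: centralizer_def)
  have fh: "bracket f h = scale 2 f"
    using hf bracket_skew[of f h] by simp
  \<comment> \<open>Both z and h + 2 s f are killed by (ad f)^2, so on them the exponential reduces
    to its linear part.\<close>
  have texp_2: "E u = u - scale s (bracket f u)" if "bracket f (bracket f u) = 0" for u
  proof -
    have "\<exists>n. CHAR('k) = Suc (Suc n)"
      using CHAR_ge_5 by (intro exI[of _ "CHAR('k) - 2"]) simp
    then obtain n where n: "CHAR('k) = Suc (Suc n)" ..
    have "(bracket f ^^ Suc (Suc k)) u = 0" for k
      by (rule ad_pow_eq_0_mono[of 2]) (use that in \<open>simp_all add: numeral_2_eq_2\<close>)
    then show ?thesis
      unfolding E_def texp_def n sum.lessThan_Suc_shift by (simp add: ecoeff_def)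
  qed
  have "E (z + scale m H) = E z + scale m (E H)"
    by (simp add: E_def texp_add texp_scale)
  also have "E z = z"
    using texp_2[of z] by (simp add: fz)
  also have "E H = h"
  proof -
    have "bracket f H = scale 2 f"
      by (simp add: H_def fh bracket_add_right bracket_scale_right bracket_self)
    then have "E H = H - scale (2 * s) f"
      using texp_2[of H] by (simp add: bracket_scale_right bracket_self mult.commute)
    then show ?thesis
      by (simp add: H_def)
  qed
  finally have "E (y - (z + scale m H)) = 0"
    unfolding E_diff z_def by simp
  moreover have "z \<in> centralizer Z"
    using z T_bracket by (auto simp: Z_def centralizer_def)
  then have "y - (z + scale m H) \<in> centralizer Z"
    using y(1) hZ fZ unfolding H_def
    by (simp add: centralizer_subspace subspace_add subspace_scale subspace_diff)
  ultimately have "y - (z + scale m H) = 0"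
    unfolding E_def by (rule texp_eq_0_imp[OF _ nil])
  then have "y = z + scale m H"
    by simp
  then show ?thesis
    using z unfolding H_def by blast
qed

text \<open>The root string from 2a passes through (p-2) a = -2a and (p-1) a = -a. So -a is again a
  root whose double is a root, and its vectors can serve as f and b.\<close>

lemma double_root_neg:
  obtains b f where "f \<in> weight_space (\<lambda>t. - a t)" "f \<noteq> 0" "b \<in> weight_space (\<lambda>t. 2 * - a t)" "b \<noteq> 0"
proof -
  have w: "w0 \<in> weight_space (\<lambda>t. of_nat 2 * a t)"
    using w0(1) by simp
  have "2 + (CHAR('k) - 3) = CHAR('k) - 1" "2 + (CHAR('k) - 4) = CHAR('k) - 2"
    using CHAR_ge_5 by linarith+
  then have neg: "of_nat (2 + (CHAR('k) - 3)) = (- 1 :: 'k)" "of_nat (2 + (CHAR('k) - 4)) = (- 2 :: 'k)"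
    using CHAR_ge_5 of_nat_diff[of 1 "CHAR('k)", where ?'a = 'k] of_nat_diff[of 2 "CHAR('k)", where ?'a = 'k]
    by (simp_all only: of_nat_CHAR of_nat_1 of_nat_numeral) simp_all
  have "2 + (CHAR('k) - 3) \<le> CHAR('k)" "2 + (CHAR('k) - 4) \<le> CHAR('k)"
    using CHAR_ge_5 by linarith+
  then show thesis
    using root_string[OF x0 u0 w w0(2) order_refl, of "CHAR('k) - 3", unfolded neg]
      root_string[OF x0 u0 w w0(2) order_refl, of "CHAR('k) - 4", unfolded neg]
    by (intro that[of "(bracket x0 ^^ (CHAR('k) - 3)) w0" "(bracket x0 ^^ (CHAR('k) - 4)) w0"]) simp_all
qed

end

section \<open>An sl(2)-triple acting on a vector of h-weight -4\<close>

context restricted_lie_algebra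
begin

text \<open>The usual formula (k+1)(l - k) for a highest weight vector of weight l = -4. Although
  \<open>b\<close> need not be killed by \<open>e\<close>, the correction (ad f)^(k+1)(c f)
  vanishes.\<close>

lemma sl2_ad_pow:
  assumes ef: "bracket e f = h" and hf: "bracket h f = scale (- 2) f" and hb: "bracket h b = scale (- 4) b"
    and eb: "bracket e b = scale c f"
  shows "bracket e ((bracket f ^^ Suc k) b) = scale (- of_nat (Suc k) * of_nat (k + 4)) ((bracket f ^^ k) b)"
proof -
  have step: "bracket e ((bracket f ^^ Suc k) b) =
      scale (- 4 - 2 * of_nat k) ((bracket f ^^ k) b) + bracket f (bracket e ((bracket f ^^ k) b))" for k
    using bracket_derivation[of e f "(bracket f ^^ k) b"]
    by (simp add: ef weight_ad_pow[OF hf] hb ad_pow_scale[of k f "- 4" b, simplified] scale_left_diff_distrib)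
  show ?thesis
  proof (induction k)
    case 0
    show ?case
      using step[of 0] by (simp add: eb bracket_scale_right bracket_self)
  next
    case (Suc k)
    have "- 4 - 2 * of_nat (Suc k) + - of_nat (Suc k) * of_nat (k + 4) =
        (- of_nat (Suc (Suc k)) * of_nat (Suc k + 4) :: 'k)"
      by (simp add: algebra_simps)
    moreover have "bracket e ((bracket f ^^ Suc (Suc k)) b) =
        scale (- 4 - 2 * of_nat (Suc k) + - of_nat (Suc k) * of_nat (k + 4)) ((bracket f ^^ Suc k) b)"
      unfolding step[of "Suc k"] Suc bracket_scale_right scale_left_distrib by simp
    ultimately show ?case
      by (simp only:)
  qed
qed

text \<open>
  On the left \<open>e - s h - s\<^sup>2 f = exp(s ad f)(e)\<close>, so without truncation the result would be
  \<open>exp(s ad f)([e, b]) = c f\<close>. The truncation makes \<open>s\<^sup>p\<close> appear.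
\<close>

lemma bracket_texp_top:
  assumes ef: "bracket e f = h" and hf: "bracket h f = scale (- 2) f" and hb: "bracket h b = scale (- 4) b"
    and eb: "bracket e b = scale c f"
    and nil: "(bracket f ^^ CHAR('k)) b = 0" and p: "CHAR('k) = Suc p"
  shows "bracket (e - scale s h - scale (s ^ 2) f) (texp f s b) =
    scale c f + scale (3 * s * ecoeff s p) ((bracket f ^^ p) b)"
proof -
  define e' where "e' = e - scale s h - scale (s ^ 2) f"
  have h_pow: "bracket h ((bracket f ^^ k) b) = - scale (4 + 2 * of_nat k) ((bracket f ^^ k) b)" for k
    unfolding weight_ad_pow[OF hf] hb ad_pow_scale scale_left_distrib by simp
  have eSuc: "bracket e' ((bracket f ^^ Suc k) b) =
      scale (- of_nat (Suc k) * of_nat (k + 4)) ((bracket f ^^ k) b)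
      + scale (s * (4 + 2 * of_nat (Suc k))) ((bracket f ^^ Suc k) b)
      - scale (s ^ 2) ((bracket f ^^ Suc (Suc k)) b)" for k
    unfolding e'_def bracket_diff_left bracket_scale_left sl2_ad_pow[OF ef hf hb eb] h_pow
    by (simp del: of_nat_Suc)
  \<comment> \<open>Two boundary terms remain after each truncation. At the last index the second
    one contains (ad f)^CHAR b = 0, while the first one survives and is the defect that is exploited
    later.\<close>
  have "bracket e' (\<Sum>k\<le>n. scale (ecoeff s k) ((bracket f ^^ k) b)) =
      scale c f + scale (s * ecoeff s n * of_nat (n + 4)) ((bracket f ^^ n) b)
      - scale (s ^ 2 * ecoeff s n) ((bracket f ^^ Suc n) b)" if "n < CHAR('k)" for n
    using that
  proof (induction n)
    case 0
    show ?case
      by (simp add: e'_def ecoeff_def bracket_diff_left bracket_scale_left eb hb mult.commute)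
  next
    case (Suc n)
    have c: "s * ecoeff s n = of_nat (Suc n) * ecoeff s (Suc n)"
      using ecoeff_Suc[OF Suc.prems, of s] by simp
    have c2: "s ^ 2 * ecoeff s n = s * (of_nat (Suc n) * ecoeff s (Suc n))"
      unfolding c[symmetric] by (simp add: power2_eq_square)
    have "bracket e' (\<Sum>k\<le>Suc n. scale (ecoeff s k) ((bracket f ^^ k) b)) =
       scale c f + scale (of_nat (Suc n) * ecoeff s (Suc n) * of_nat (n + 4)) ((bracket f ^^ n) b)
      - scale (s * (of_nat (Suc n) * ecoeff s (Suc n))) ((bracket f ^^ Suc n) b)
      + scale (ecoeff s (Suc n)) (scale (- of_nat (Suc n) * of_nat (n + 4)) ((bracket f ^^ n) b)
      + scale (s * (4 + 2 * of_nat (Suc n))) ((bracket f ^^ Suc n) b)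
      - scale (s ^ 2) ((bracket f ^^ Suc (Suc n)) b))"
      using Suc unfolding sum.atMost_Suc bracket_add_right bracket_scale_right eSuc c c2 by simp
    also have "\<dots> = scale c f + scale (of_nat (Suc n) * ecoeff s (Suc n) * of_nat (n + 4)
         + ecoeff s (Suc n) * (- of_nat (Suc n) * of_nat (n + 4))) ((bracket f ^^ n) b)
      + scale (ecoeff s (Suc n) * (s * (4 + 2 * of_nat (Suc n))) - s * (of_nat (Suc n) * ecoeff s (Suc n))) ((bracket f ^^ Suc n) b)
      - scale (ecoeff s (Suc n) * s ^ 2) ((bracket f ^^ Suc (Suc n)) b)"
      unfolding scale_left_distrib scale_left_diff_distrib scale_right_distrib scale_right_diff_distrib scale_scale
      by (simp del: of_nat_Suc funpow.simps)
    also have "of_nat (Suc n) * ecoeff s (Suc n) * of_nat (n + 4)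
         + ecoeff s (Suc n) * (- of_nat (Suc n) * of_nat (n + 4)) = 0"
      by (simp add: algebra_simps)
    also have "ecoeff s (Suc n) * (s * (4 + 2 * of_nat (Suc n))) - s * (of_nat (Suc n) * ecoeff s (Suc n))
        = s * ecoeff s (Suc n) * of_nat (Suc n + 4)"
      by (simp add: algebra_simps)
    finally show ?case
      by (simp add: mult.commute)
  qed
  from this[of p] have "bracket e' (texp f s b) =
      scale c f + scale (s * ecoeff s p * of_nat (p + 4)) ((bracket f ^^ p) b)"
    using nil unfolding texp_def p lessThan_Suc_atMost by simp
  \<comment> \<open>Here \<open>p\<close> is one less than the characteristic.\<close>
  also have "of_nat (p + 4) = (3 :: 'k)"
  proof -
    have "of_nat (Suc p) = (0 :: 'k)"
      unfolding p[symmetric] by (rule of_nat_CHAR)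
    moreover have "of_nat (p + 4) = (of_nat (Suc p) + 3 :: 'k)"
      by simp
    ultimately show ?thesis
      by simp
  qed
  finally show ?thesis
    unfolding e'_def by (simp add: mult.commute)
qed

end

section \<open>Commuting eigenvectors of h + 2 s f and the contradiction\<close>

context double_root
begin

text \<open>The analogue for h + 2 s f of correcting a root vector by an element of
  \<open>T\<close>. As ad u squared kills H = h + 2 s f, u^[p] commutes with H and is therefore z +
  m H. It also commutes with \<open>u\<close>, whose eigenvalue is nonzero, so m = 0 and u^[p] has a
  p-th root in \<open>Z\<close>.\<close>

lemma conjugate_eigenvector_nilpotent:
  assumes f: "f \<in> weight_space (\<lambda>t. - a t)" "f \<noteq> 0" and h: "h \<in> T" "a h = 2"
    and u: "u \<in> centralizer Z" "u \<noteq> 0" "bracket (h + scale (2 * s) f) u = scale l u" "l \<noteq> 0"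
  obtains z where "z \<in> Z" "pmap (u - z) = 0" "u - z \<noteq> 0"
proof -
  define H where "H = h + scale (2 * s) f"
  have uH: "bracket u H = scale (- l) u"
    using u(3) bracket_skew[of u H] by (simp add: H_def)
  have "bracket (pmap u) H = 0"
    unfolding ad_pmap by (rule ad_pow_eq_0_mono[of 2])
      (use CHAR_ge_5 in \<open>simp_all add: numeral_2_eq_2 uH bracket_minus_right bracket_scale_right bracket_self\<close>)
  then have "bracket (h + scale (2 * s) f) (pmap u) = 0"
    using bracket_skew[of H "pmap u"] by (simp add: H_def)
  then obtain z m where z: "z \<in> Z" "pmap u = z + scale m H"
    using centralizer_conjugate_torus[OF f h centralizer_pmap[OF u(1)]] unfolding H_def by blast
  have zu: "bracket z u = 0" "bracket u z = 0" if "z \<in> Z" for z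
    using that u(1) bracket_skew[of z u] by (auto simp: centralizer_def)
  have "scale (m * l) u = bracket (pmap u) u"
    by (simp add: z bracket_add_left bracket_scale_left u(3)[folded H_def] zu)
  then have "m = 0"
    using u(2,4) by (simp add: bracket_pmap_self)
  then have "pmap u \<in> Z"
    using z by simp
  then obtain s' where s': "s' \<in> Z" "pmap s' = pmap u"
    using Z_pmap_root by blast
  have "pmap (u - s') = 0"
    using pmap_add_commuting[of u "- s'"] zu[OF s'(1)] s'(2) by (simp add: bracket_minus_right pmap_minus)
  moreover have "u - s' \<noteq> 0"
  proof
    assume "u - s' = 0"
    then have "bracket u H = 0"
      using s'(1) f h T_bracket[of s' h] Z_weight_space[of s' f "-1"]
      by (simp add: H_def bracket_add_right bracket_scale_right Z_def)
    then show False
      using uH u(2,4) by simp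
  qed
  ultimately show thesis
    using that s'(1) by blast
qed

text \<open>\<open>e'\<close> and \<open>v\<close> are eigenvectors of \<open>H\<close> for 2 and -4
  and commute for the right s. Modulo \<open>Z\<close> both are nilpotent, so p-rank 1 makes them
  proportional there, which the distinct eigenvalues forbid.\<close>

lemma double_root_False: False
proof -
  obtain b f0 where f0: "f0 \<in> weight_space (\<lambda>t. - a t)" "f0 \<noteq> 0"
    and b: "b \<in> weight_space (\<lambda>t. 2 * - a t)" "b \<noteq> 0"
    by (rule double_root_neg)
  define e where "e = x0"
  have e: "e \<in> weight_space a" "e \<noteq> 0"
    using x0 by (simp_all add: e_def)
  note a_scale = weight_scale[OF e] and a_add = weight_add[OF e]
  have ef0: "bracket e f0 \<in> T" "a (bracket e f0) \<noteq> 0"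
    using weight_space_bracket_T[OF e(1) f0(1)] opposite_root_vectors[OF e f0] by simp_all
  define f where "f = scale (2 / a (bracket e f0)) f0"
  have f: "f \<in> weight_space (\<lambda>t. - a t)" "f \<noteq> 0"
    using f0 ef0 numeral_neq_0 by (simp_all add: f_def weight_space_subspace subspace_scale)
  define h where "h = bracket e f"
  have h: "h \<in> T" "a h = 2"
    using weight_space_bracket_T[OF e(1) f(1)] a_scale[OF ef0(1)] ef0(2)
    by (simp_all add: h_def f_def bracket_scale_right)
  have he: "bracket h e = scale 2 e" and hf: "bracket h f = scale (- 2) f" and hb: "bracket h b = scale (- 4) b"
    using weight_spaceD(1)[OF e(1) h(1)] weight_spaceD(1)[OF f(1) h(1)] weight_spaceD(1)[OF b(1) h(1)] h(2)
    by simp_all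
  obtain c where eb: "bracket e b = scale c f"
  proof -
    define u where "u = bracket e b"
    have u: "u \<in> weight_space (\<lambda>t. - a t)"
      unfolding u_def by (rule weight_space_bracketI[OF e(1) b(1)]) simp
    \<comment> \<open>The multiple of \<open>f\<close> is chosen, using a h = 2, so that
      \<open>a\<close> vanishes on [e, v]. Then \<open>opposite_root_vectors\<close> forces v =
      0.\<close>
    define v where "v = u - scale (a (bracket e u) / 2) f"
    have eu: "bracket e u \<in> T"
      using weight_space_bracket_T[OF e(1) u] by simp
    have v: "v \<in> weight_space (\<lambda>t. - a t)"
      unfolding v_def using u f(1) by (simp add: weight_space_subspace subspace_scale subspace_diff)
    have ev: "bracket e v = bracket e u + scale (- (a (bracket e u) / 2)) h"
      by (simp add: v_def bracket_diff_right bracket_scale_right h_def)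
    have "a (bracket e v) = a (bracket e u) + - (a (bracket e u) / 2) * a h"
      unfolding ev a_add[OF eu subspace_scale[OF T_subspace h(1)]] a_scale[OF h(1)] ..
    then have "a (bracket e v) = 0"
      using numeral_neq_0 by (simp add: h(2))
    then have "v = 0"
      using opposite_root_vectors[OF e v] by blast
    then show thesis
      using that by (simp add: v_def u_def)
  qed
  obtain p where p: "CHAR('k) = Suc p"
    using CHAR_pos gr0_conv_Suc by blast
  obtain n where n: "p = Suc (Suc n)"
    using CHAR_ge_5 p that[of "p - 2"] by simp
  \<comment> \<open>(ad f)^n b with n = CHAR - 3 has weight a. One further step therefore gives a
    toral element, on which \<open>a\<close> is nonzero because it is the bracket of opposite root
    vectors, and the step after that returns to \<open>f\<close>.\<close>
  define t where "t = (bracket f ^^ Suc n) b"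
  have t: "t \<in> T" "a t \<noteq> 0"
  proof -
    define g where "g = (bracket f ^^ n) b"
    have b': "b \<in> weight_space (\<lambda>t. of_nat 2 * - a t)"
      using b(1) by simp
    have "- a u0 \<noteq> 0"
      using u0(2) by simp
    note str = root_string[OF f u0(1) this b' b(2), of n]
    have pn: "of_nat (2 + n) = (- 1 :: 'k)"
    proof -
      have "of_nat (Suc (2 + n)) = (0 :: 'k)"
        using of_nat_CHAR[where ?'a = 'k] unfolding p n by simp
      then show ?thesis
        by (simp add: add.commute eq_neg_iff_add_eq_0)
    qed
    have g: "g \<in> weight_space a" "g \<noteq> 0"
      using str p n unfolding pn g_def by simp_all
    have gf: "bracket g f \<in> T" "a (bracket g f) \<noteq> 0"
      using weight_space_bracket_T[OF g(1) f(1)] opposite_root_vectors[OF g f] by simp_all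
    have "t = scale (- 1) (bracket g f)"
      using bracket_skew[of f g] by (simp add: t_def g_def)
    then show "t \<in> T" "a t \<noteq> 0"
      using gf a_scale[OF gf(1), of "- 1"] by (simp_all add: T_subspace subspace_neg)
  qed
  have fp: "(bracket f ^^ p) b = scale (a t) f"
    using weight_spaceD(2)[OF f(1) t(1)] unfolding n by (simp add: t_def)
  then have nil: "(bracket f ^^ CHAR('k)) b = 0"
    unfolding p by (simp add: bracket_scale_right bracket_self)
  have "CHAR('k) > 0"
    by (rule CHAR_pos)
  \<comment> \<open>Solves c + 3 s s^p a(t) / p! = 0, where s s^p = s^CHAR. The left side is the
    coefficient of \<open>f\<close> that \<open>bracket_texp_top\<close> yields.\<close>
  then obtain s where s: "s ^ CHAR('k) = - c * of_nat (fact p) / (3 * a t)"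
    using nth_root_exists by blast
  have "of_nat (fact p) \<noteq> (0 :: 'k)"
    using p by (intro fact_neq_0) simp
  then have "c + 3 * s * ecoeff s p * a t = 0"
    using s t(2) numeral_neq_0 unfolding p by (simp add: ecoeff_def field_simps)
  then have sc: "scale c f + scale (3 * s * ecoeff s p) (scale (a t) f) = 0"
    by (simp flip: scale_left_distrib)
  define v where "v = texp f s b"
  define e' where "e' = e - scale s h - scale (s ^ 2) f"
  define H where "H = h + scale (2 * s) f"
  have e'v: "bracket e' v = 0"
    using bracket_texp_top[OF h_def[symmetric] hf hb eb nil p, of s] sc by (simp add: e'_def v_def fp)
  have Hv: "bracket H v = scale (- 4) v"
    using texp_conjugates[OF hf nil, of s] texp_scale[of f s "- 4" b] by (simp add: H_def v_def hb)
  have fe: "bracket f e = - h" and fh: "bracket f h = scale 2 f"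
    using bracket_skew[of f e] hf bracket_skew[of f h] by (simp_all add: h_def)
  have "bracket H e' = scale 2 e - scale (2 * s) h + scale (2 * s ^ 2 - 4 * s ^ 2) f"
    unfolding H_def e'_def bracket_add_left bracket_diff_right bracket_scale_left bracket_scale_right
      he hf fe fh bracket_self T_bracket[OF h(1) h(1)] scale_left_diff_distrib
    by (simp add: bracket_minus_right scale_right_diff_distrib power2_eq_square algebra_simps)
  also have "\<dots> = scale 2 e'"
    by (simp add: e'_def scale_right_diff_distrib)
  finally have He': "bracket H e' = scale 2 e'" .
  have v0: "v \<noteq> 0"
    using texp_eq_0_imp[OF _ nil] b(2) unfolding v_def by blast
  have e'0: "e' \<noteq> 0"
  proof
    assume "e' = 0"
    then have "bracket f (bracket f e') = 0"
      by simp
    then have "scale 2 f = 0"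
      by (simp add: e'_def bracket_diff_right bracket_scale_right fe fh bracket_self bracket_minus_right)
    then show False
      using f(2) numeral_neq_0 by simp
  qed
  have Zc: "e \<in> centralizer Z" "f \<in> centralizer Z" "b \<in> centralizer Z"
    using weight_space_centralizer_Z[of e 1] weight_space_centralizer_Z[of f "- 1"]
      weight_space_centralizer_Z[of b "- 2"] e(1) f(1) b(1) by simp_all
  have e'Z: "e' \<in> centralizer Z"
    unfolding e'_def h_def using Zc
    by (intro subspace_diff subspace_scale centralizer_subspace centralizer_bracket)
  have "(bracket f ^^ k) b \<in> centralizer Z" for k
    by (induction k) (use Zc in \<open>auto intro: centralizer_bracket\<close>)
  then have vZ: "v \<in> centralizer Z"
    unfolding v_def texp_def by (intro subspace_sum subspace_scale centralizer_subspace)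
  obtain z where z: "z \<in> Z" "pmap (v - z) = 0" "v - z \<noteq> 0"
    using conjugate_eigenvector_nilpotent[OF f h vZ v0 Hv[unfolded H_def]] numeral_neq_0 by auto
  obtain z' where z': "z' \<in> Z" "pmap (e' - z') = 0" "e' - z' \<noteq> 0"
    using conjugate_eigenvector_nilpotent[OF f h e'Z e'0 He'[unfolded H_def]] numeral_neq_0 by auto
  have zc: "bracket u z = 0" "bracket z u = 0" if "z \<in> Z" "u \<in> centralizer Z" for u z
    using that bracket_skew[of z u] by (auto simp: centralizer_def)
  have "bracket (e' - z') (v - z) = 0"
    using e'v zc[OF z(1) e'Z] zc[OF z'(1) vZ] z z' T_bracket[of z' z]
    by (simp add: bracket_diff_left bracket_diff_right Z_def)
  then obtain d where d: "v - z = scale d (e' - z')"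
    using p_rank_1_commuting_nullcone[OF p_rank, of "e' - z'" "v - z"] z z' by (auto simp: nullcone_def)
  have HZ: "H \<in> centralizer Z"
    unfolding H_def h_def using Zc
    by (intro subspace_add subspace_scale centralizer_subspace centralizer_bracket)
  have "bracket H (v - z) = scale (- 4) v" "bracket H (e' - z') = scale 2 e'"
    using Hv He' zc[OF z(1) HZ] zc[OF z'(1) HZ] by (simp_all add: bracket_diff_right)
  then have ve: "scale (- 4) v = scale (d * 2) e'"
    unfolding d by (simp add: bracket_scale_right)
  \<comment> \<open>ad H acts by -4 on the left and by 2 on the right, which leads to (-4 - 2)(-4) v
    = 0.\<close>
  then have "bracket H (scale (- 4) v) = bracket H (scale (d * 2) e')"
    by simp
  then have "scale (- 4) (scale (- 4) v) = scale 2 (scale (d * 2) e')"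
    unfolding bracket_scale_right Hv He' by (simp add: mult.commute)
  then have "scale (- 4) (scale (- 4) v) = scale 2 (scale (- 4) v)"
    unfolding ve .
  then have "scale (- 4 - 2) (scale (- 4) v) = 0"
    unfolding scale_left_diff_distrib by simp
  moreover have "(- 4 - 2 :: 'k) * - 4 \<noteq> 0"
    using numeral_neq_0 by (simp only: mult_eq_0_iff) simp
  ultimately show False
    using v0 by (simp only: scale_scale scale_eq_0_iff simp_thms)
qed

end

section \<open>Quotients by the center\<close>

context restricted_lie_algebra
begin

text \<open>
  The \<open>p\<close>-map of a centerless algebra is determined by the bracket, so it need not be compared.
\<close>

lemma quotient_center_iso:
  fixes M :: "('k, 'b) lie_struct" and \<psi> :: "'b \<Rightarrow> 'g"
  assumes closed: "\<And>A B. A \<in> carr M \<Longrightarrow> B \<in> carr M \<Longrightarrow> ladd M A B \<in> carr M"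
      "\<And>c A. A \<in> carr M \<Longrightarrow> lscale M c A \<in> carr M"
      "\<And>A B. A \<in> carr M \<Longrightarrow> B \<in> carr M \<Longrightarrow> lbracket M A B \<in> carr M"
      "\<And>A. A \<in> carr M \<Longrightarrow> lpmap M A \<in> carr M"
    and ad: "\<And>A B. A \<in> carr M \<Longrightarrow> B \<in> carr M \<Longrightarrow>
      lbracket M (lpmap M A) B = (lbracket M A ^^ CHAR('k)) B"
    and centerless: "\<And>A A'. A \<in> carr M \<Longrightarrow> A' \<in> carr M \<Longrightarrow>
      (\<And>B. B \<in> carr M \<Longrightarrow> lbracket M A B = lbracket M A' B) \<Longrightarrow> A = A'"
    and add: "\<And>A B. A \<in> carr M \<Longrightarrow> B \<in> carr M \<Longrightarrow> \<psi> (ladd M A B) = \<psi> A + \<psi> B"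
    and scl: "\<And>c A. A \<in> carr M \<Longrightarrow> \<psi> (lscale M c A) = scale c (\<psi> A)"
    and br: "\<And>A B. A \<in> carr M \<Longrightarrow> B \<in> carr M \<Longrightarrow> \<psi> (lbracket M A B) - bracket (\<psi> A) (\<psi> B) \<in> center"
    and inj: "\<And>A B. A \<in> carr M \<Longrightarrow> B \<in> carr M \<Longrightarrow> \<psi> A - \<psi> B \<in> center \<Longrightarrow> A = B"
    and surj: "\<And>y. \<exists>A\<in>carr M. y - \<psi> A \<in> center"
  shows "quotient_algebra center \<cong>\<^sub>p M"
proof -
  define q where "q x = cosets center `` {x}" for x
  define Q where "Q = quotient_algebra center"
  note Q = quotient_center_simps[folded q_def Q_def]
  have q_eq: "q x = q y \<longleftrightarrow> x - y \<in> center" for x y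
    using eq_equiv_class_iff[OF equiv_cosets[OF center_subspace], of x y]
    by (simp add: q_def cosets_def)
  have bij: "bij_betw (\<lambda>A. q (\<psi> A)) (carr M) (carr Q)"
    unfolding bij_betw_def
  proof
    show "inj_on (\<lambda>A. q (\<psi> A)) (carr M)"
      by (rule inj_onI) (use inj q_eq in blast)
    show "(\<lambda>A. q (\<psi> A)) ` carr M = carr Q"
      unfolding Q(5) using surj q_eq by (auto simp: image_iff)
  qed
  \<comment> \<open>The explicit formula goes from the model to representatives in the algebra, so
    the isomorphism is the inverse map.\<close>
  define f where "f = inv_into (carr M) (\<lambda>A. q (\<psi> A))"
  have f: "f (q (\<psi> A)) = A" if "A \<in> carr M" for A
    unfolding f_def using bij_betw_inv_into_left[OF bij that] by simp
  have rep: "\<exists>A\<in>carr M. X = q (\<psi> A)" if "X \<in> carr Q" for X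
    using bij that unfolding bij_betw_def by blast
  have ad_pow: "(lbracket M A ^^ n) B \<in> carr M \<and>
      \<psi> ((lbracket M A ^^ n) B) - (bracket (\<psi> A) ^^ n) (\<psi> B) \<in> center"
    if "A \<in> carr M" "B \<in> carr M" for A B n
  proof (induction n)
    case 0
    show ?case
      using that subspace_0[OF center_subspace] by simp
  next
    case (Suc n)
    define C where "C = (lbracket M A ^^ n) B"
    define c where "c = (bracket (\<psi> A) ^^ n) (\<psi> B)"
    have C: "C \<in> carr M" "\<psi> C - c \<in> center"
      using Suc by (simp_all add: C_def c_def)
    have "bracket (\<psi> A) (\<psi> C) = bracket (\<psi> A) c"
      using centerD(2)[OF C(2), of "\<psi> A"] by (simp add: bracket_diff_right)
    then show ?case
      using closed(3)[OF that(1) C(1)] br[OF that(1) C(1)] by (simp flip: C_def c_def)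
  qed
  have pm: "q (pmap (\<psi> A)) = q (\<psi> (lpmap M A))" if A: "A \<in> carr M" for A
  proof -
    obtain D where D: "D \<in> carr M" "pmap (\<psi> A) - \<psi> D \<in> center"
      using surj by blast
    have "D = lpmap M A"
    proof (rule centerless[OF D(1) closed(4)[OF A]])
      fix B assume B: "B \<in> carr M"
      have "bracket (\<psi> D) (\<psi> B) = bracket (pmap (\<psi> A)) (\<psi> B)"
        using centerD(1)[OF D(2), of "\<psi> B"] by (simp add: bracket_diff_left)
      also have "\<dots> = (bracket (\<psi> A) ^^ CHAR('k)) (\<psi> B)"
        by (rule ad_pmap)
      finally have "\<psi> (lbracket M D B) - (bracket (\<psi> A) ^^ CHAR('k)) (\<psi> B) \<in> center"
        using br[OF D(1) B] by simp
      moreover have "\<psi> (lbracket M (lpmap M A) B) - (bracket (\<psi> A) ^^ CHAR('k)) (\<psi> B) \<in> center"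
        unfolding ad[OF A B] using ad_pow[OF A B] by blast
      ultimately have "\<psi> (lbracket M D B) - \<psi> (lbracket M (lpmap M A) B) \<in> center"
        using subspace_diff[OF center_subspace] by fastforce
      then show "lbracket M D B = lbracket M (lpmap M A) B"
        using D(1) A B closed by (intro inj) auto
    qed
    then show ?thesis
      using D(2) q_eq by blast
  qed
  have qbr: "q (bracket (\<psi> A) (\<psi> B)) = q (\<psi> (lbracket M A B))" if "A \<in> carr M" "B \<in> carr M" for A B
    using br[OF that] q_eq by metis
  have "restricted_iso Q M f"
    unfolding restricted_iso_def
  proof (intro conjI ballI allI)
    show "bij_betw f (carr Q) (carr M)"
      unfolding f_def by (rule bij_betw_inv_into[OF bij])
    fix X assume "X \<in> carr Q"
    then obtain A where A: "A \<in> carr M" "X = q (\<psi> A)"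
      using rep by blast
    show "f (lscale Q c X) = lscale M c (f X)" for c
      using A closed by (simp add: Q f flip: scl)
    show "f (lpmap Q X) = lpmap M (f X)"
      using A closed by (simp add: Q f pm)
    fix Y assume "Y \<in> carr Q"
    then obtain B where B: "B \<in> carr M" "Y = q (\<psi> B)"
      using rep by blast
    show "f (ladd Q X Y) = ladd M (f X) (f Y)"
      using A B closed by (simp add: Q f flip: add)
    show "f (lbracket Q X Y) = lbracket M (f X) (f Y)"
      using A B closed by (simp add: Q f qbr)
  qed
  then show ?thesis
    unfolding restricted_isomorphic_def Q_def by blast
qed

end

section \<open>Powers of trace-zero 2 x 2 matrices\<close>

lemma matrix2_eqI:
  "A$1$1 = B$1$1 \<Longrightarrow> A$1$2 = B$1$2 \<Longrightarrow> A$2$1 = B$2$1 \<Longrightarrow> A$2$2 = B$2$2 \<Longrightarrow> A = (B :: 'a^2^2)"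
  by (simp add: vec_eq_iff forall_2)

context
  fixes A :: "'k::field^2^2" and d :: 'k
  assumes tr: "trace A = 0"
  defines "d \<equiv> A$1$1 ^ 2 + A$1$2 * A$2$1"
begin

private lemma tr22: "A$2$2 = - A$1$1"
  using tr by (simp add: trace_def sum_2 eq_neg_iff_add_eq_0 add.commute)

text \<open>Cayley-Hamilton for trace zero: the square of \<open>A\<close> is the scalar d = - det
  A.\<close>

lemma trace_0_square: "A ** (A ** B) = (\<chi> i j. d * B$i$j)" for B :: "'k^2^2"
  by (rule matrix2_eqI)
    (simp_all add: matrix_matrix_mult_def sum_2 tr22 d_def power2_eq_square algebra_simps)

lemma trace_0_mat_power: "mat_power A (Suc (2 * m)) = (\<chi> i j. d ^ m * A$i$j)"
proof (induction m)
  case 0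
  show ?case
    by (simp add: mat_power_def vec_eq_iff)
next
  case (Suc m)
  have "mat_power A (Suc (2 * Suc m)) = A ** (A ** mat_power A (Suc (2 * m)))"
    by (simp add: mat_power_def)
  then show ?case
    unfolding trace_0_square Suc by (simp add: mult.assoc)
qed

text \<open>ad A has eigenvalues 0 and +-2 sqrt d, so (ad A)^3 = 4 d ad A.\<close>

lemma trace_0_ad_power:
  "((\<lambda>B. A ** B - B ** A) ^^ Suc (2 * m)) B = (\<chi> i j. (4 * d) ^ m * (A ** B - B ** A)$i$j)"
proof (induction m)
  case 0
  show ?case
    by (simp add: vec_eq_iff)
next
  case (Suc m)
  define D where "D = (\<lambda>B. A ** B - B ** A)"
  have cube: "D (D (D B)) = (\<chi> i j. 4 * d * D B $ i $ j)" for B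
    by (rule matrix2_eqI)
      (simp_all add: D_def matrix_matrix_mult_def sum_2 tr22 d_def power2_eq_square algebra_simps)
  have hom: "D (\<chi> i j. c * B$i$j) = (\<chi> i j. c * D B$i$j)" for c B
    by (rule matrix2_eqI) (simp_all add: D_def matrix_matrix_mult_def sum_2 algebra_simps)
  have Suc': "(D ^^ Suc (2 * m)) B = (\<chi> i j. (4 * d) ^ m * D B$i$j)"
    using Suc unfolding D_def .
  have "(D ^^ Suc (2 * Suc m)) B = D (D ((D ^^ Suc (2 * m)) B))"
    by simp
  also have "\<dots> = (\<chi> i j. (4 * d) ^ m * D (D (D B)) $ i $ j)"
    unfolding Suc' hom ..
  also have "\<dots> = (\<chi> i j. (4 * d) ^ Suc m * D B $ i $ j)"
    unfolding cube by (simp add: mult_ac)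
  finally show ?case
    by (simp add: D_def)
qed

end

text \<open>With p = 2 m + 1 the two scalars are d^m and (4 d)^m. They agree because 4^m = 2^(p-1) =
  1 in the field.\<close>

lemma trace_0_ad_CHAR:
  fixes A :: "'k::field^2^2"
  assumes tr: "trace A = 0" and p: "CHAR('k) > 2"
  obtains c where "mat_power A CHAR('k) = (\<chi> i j. c * A$i$j)"
    and "\<And>B. ((\<lambda>B. A ** B - B ** A) ^^ CHAR('k)) B = (\<chi> i j. c * (A ** B - B ** A)$i$j)"
proof -
  have prime: "prime CHAR('k)"
    using p by (intro prime_CHAR_semidom) simp
  then have "odd CHAR('k)"
    using p prime_odd_nat by blast
  then obtain m where m: "CHAR('k) = Suc (2 * m)"
    by (metis oddE Suc_eq_plus1)
  have two: "(2 :: 'k) \<noteq> 0"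
    using of_nat_eq_0_iff_char_dvd[of 2, where ?'a = 'k] p by (auto dest: dvd_imp_le)
  have "(2 :: 'k) ^ CHAR('k) = (1 + 1) ^ CHAR('k)"
    by simp
  also have "\<dots> = 2"
    unfolding freshmans_dream[OF prime refl] by simp
  finally have "(4 :: 'k) ^ m = 1"
    using two by (simp add: m power_mult)
  then have four: "(4 * d) ^ m = d ^ m" for d :: 'k
    by (simp only: power_mult_distrib mult_1)
  show thesis
    by (rule that[OF trace_0_mat_power[OF tr, of m, folded m]
          trace_0_ad_power[OF tr, of m, folded m, unfolded four]])
qed

text \<open>Serves sl(2) and its Borel subalgebra at once: both contain \<open>E\<close> and
  \<open>H\<close>, and the commutators with these two determine a trace-zero matrix, whence
  centerlessness.\<close>

lemma (in restricted_lie_algebra) quotient_center_iso_matrix: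
  fixes S :: "('k^2^2) set" and \<psi> :: "'k^2^2 \<Rightarrow> 'g"
  defines "E \<equiv> \<chi> i j. if i = 1 \<and> j = 2 then 1 else 0" and "H \<equiv> \<chi> i j. if i = j then if i = 1 then 1 else - 1 else 0"
  assumes p: "CHAR('k) > 2"
    and S: "\<And>A. A \<in> S \<Longrightarrow> trace A = 0" "E \<in> S" "H \<in> S"
    and closed: "\<And>A B. A \<in> S \<Longrightarrow> B \<in> S \<Longrightarrow> A + B \<in> S" "\<And>c A. A \<in> S \<Longrightarrow> (\<chi> i j. c * A$i$j) \<in> S"
      "\<And>A B. A \<in> S \<Longrightarrow> B \<in> S \<Longrightarrow> A ** B - B ** A \<in> S"
    and add: "\<And>A B. \<psi> (A + B) = \<psi> A + \<psi> B"
    and scl: "\<And>c A. \<psi> (\<chi> i j. c * A$i$j) = scale c (\<psi> A)"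
    and br: "\<And>A B. A \<in> S \<Longrightarrow> B \<in> S \<Longrightarrow> \<psi> (A ** B - B ** A) - bracket (\<psi> A) (\<psi> B) \<in> center"
    and inj: "\<And>A. A \<in> S \<Longrightarrow> \<psi> A \<in> center \<Longrightarrow> A = 0"
    and surj: "\<And>y. \<exists>A\<in>S. y - \<psi> A \<in> center"
  shows "quotient_algebra center \<cong>\<^sub>p matrix_lie_struct S"
proof -
  have two: "(2 :: 'k) \<noteq> 0"
    using of_nat_eq_0_iff_char_dvd[of 2, where ?'a = 'k] p by (auto dest: dvd_imp_le)
  have neg: "- A = (\<chi> i j. (- 1) * A$i$j)" for A :: "'k^2^2"
    by (simp add: vec_eq_iff)
  show ?thesis
  proof (rule quotient_center_iso[where \<psi> = \<psi>];
      unfold matrix_lie_struct_def lie_struct.simps)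
    fix A A' :: "'k^2^2" and c
    assume A: "A \<in> S"
    show "(\<chi> i j. c * A$i$j) \<in> S" "\<psi> (\<chi> i j. c * A$i$j) = scale c (\<psi> A)"
      using A closed scl by auto
    obtain c where c: "mat_power A CHAR('k) = (\<chi> i j. c * A$i$j)"
      "\<And>B. ((\<lambda>B. A ** B - B ** A) ^^ CHAR('k)) B = (\<chi> i j. c * (A ** B - B ** A)$i$j)"
      using trace_0_ad_CHAR[OF S(1)[OF A] p] by blast
    show "mat_power A CHAR('k) \<in> S"
      unfolding c using A by (rule closed)
    show "mat_power A CHAR('k) ** B - B ** mat_power A CHAR('k) = ((\<lambda>B. A ** B - B ** A) ^^ CHAR('k)) B" for B
      unfolding c by (rule matrix2_eqI) (simp_all add: matrix_matrix_mult_def sum_2 algebra_simps)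
    assume A': "A' \<in> S"
    show "A + A' \<in> S" "\<psi> (A + A') = \<psi> A + \<psi> A'" "A ** A' - A' ** A \<in> S"
      "\<psi> (A ** A' - A' ** A) - bracket (\<psi> A) (\<psi> A') \<in> center"
      using A A' closed add br by auto
    {
      assume "\<psi> A - \<psi> A' \<in> center"
      then have "\<psi> (A + - A') \<in> center"
        unfolding add unfolding neg scl by simp
      moreover have "A + - A' \<in> S"
        unfolding neg using A A' closed by blast
      ultimately show "A = A'"
        using inj[of "A + - A'"] by simp
    next
      assume eq: "\<And>B. B \<in> S \<Longrightarrow> A ** B - B ** A = A' ** B - B ** A'"
      have tr: "A$2$2 = - A$1$1" "A'$2$2 = - A'$1$1"
        using S(1)[OF A] S(1)[OF A'] by (simp_all add: trace_def sum_2 eq_neg_iff_add_eq_0 add.commute)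
      have "2 * A$1$2 = 2 * A'$1$2" "2 * A$2$1 = 2 * A'$2$1" "2 * A$1$1 = 2 * A'$1$1"
        using eq[OF S(3)] eq[OF S(2)]
        by (simp_all add: vec_eq_iff forall_2 matrix_matrix_mult_def sum_2 E_def H_def tr)
      then show "A = A'"
        using two tr by (intro matrix2_eqI) simp_all
    }
  qed (use surj in simp)
qed

section \<open>Classification\<close>

text \<open>Centrality of [e, f] is the relation [x, y] = 0 of the model, read modulo the
  center.\<close>

lemma (in restricted_lie_algebra) quotient_center_iso_borel_sl2_minus:
  fixes h e f :: 'g
  defines "\<psi> \<equiv> \<lambda>(a, b, c). scale a h + scale b e + scale c f"
  assumes p: "CHAR('k) > 2"
    and br: "bracket h e = e" "bracket h f = - f" "bracket e f \<in> center"
    and inj: "\<And>a b c. scale a h + scale b e + scale c f \<in> center \<Longrightarrow> a = 0 \<and> b = 0 \<and> c = 0"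
    and surj: "\<And>y. \<exists>a b c. y - (scale a h + scale b e + scale c f) \<in> center"
  shows "quotient_algebra center \<cong>\<^sub>p borel_sl2_minus"
proof (rule quotient_center_iso[where \<psi> = \<psi>]; unfold borel_sl2_minus_def lie_struct.simps)
  interpret bm: fin_dim_restricted_lie_algebra bm_scale "bm_bracket :: 'k triple \<Rightarrow> _" bm_pmap
    by (rule fin_dim_restricted_lie_algebra_bm[OF p])
  have brs: "bracket e h = - e" "bracket f h = f" "bracket f e = - bracket e f"
    using br bracket_skew[of e h] bracket_skew[of f h] bracket_skew[of f e] by simp_all
  fix A B :: "'k triple"
  obtain a b c a' b' c' where A: "A = (a, b, c)" and B: "B = (a', b', c')"
    by (metis prod.exhaust)
  show "bm_bracket (bm_pmap A) B = (bm_bracket A ^^ CHAR('k)) B"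
    by (rule bm.ad_pmap)
  show "\<psi> (A + B) = \<psi> A + \<psi> B" "\<psi> (bm_scale r A) = scale r (\<psi> A)" for r
    by (simp_all add: A B \<psi>_def scale_left_distrib scale_right_distrib)
  have "\<psi> (bm_bracket A B) - bracket (\<psi> A) (\<psi> B) = scale (- (b * c' - c * b')) (bracket e f)"
    by (simp add: A B \<psi>_def br brs bracket_self bracket_add_left bracket_add_right bracket_scale_left
        bracket_scale_right scale_left_distrib scale_left_diff_distrib bracket_minus_right bracket_minus_left
        scale_right_distrib scale_right_diff_distrib mult.commute)
  then show "\<psi> (bm_bracket A B) - bracket (\<psi> A) (\<psi> B) \<in> center"
    using br(3) center_subspace subspace_scale by metis
  show "A = A'" if "\<And>B. B \<in> UNIV \<Longrightarrow> bm_bracket A B = bm_bracket A' B" for A'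
    using that[of "(1, 0, 0)"] that[of "(0, 1, 0)"] by (cases A') (simp add: A)
  assume "\<psi> A - \<psi> B \<in> center"
  then have "scale (a - a') h + scale (b - b') e + scale (c - c') f \<in> center"
    by (simp add: A B \<psi>_def scale_left_diff_distrib algebra_simps)
  then show "A = B"
    using inj by (fastforce simp: A B)
next
  fix y
  obtain a b c where "y - (scale a h + scale b e + scale c f) \<in> center"
    using surj by blast
  then show "\<exists>A\<in>UNIV. y - \<psi> A \<in> center"
    by (intro bexI[of _ "(a, b, c)"]) (simp_all add: \<psi>_def)
qed simp_all

context toral_p_rank_1
begin

lemma double_root_space_trivial:
  assumes "x \<in> weight_space a" "x \<noteq> 0" "t \<in> T" "a t \<noteq> 0" "w \<in> weight_space (\<lambda>t. 2 * a t)"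
  shows "w = 0"
proof (rule ccontr)
  assume "w \<noteq> 0"
  then interpret double_root scale bracket pmap T a x w t
    using assms by unfold_locales
  show False
    by (rule double_root_False)
qed

text \<open>[x, y] has weight 2a, which is no longer a root, so \<open>x\<close> and
  \<open>y\<close> commute.\<close>

lemma root_space_dim_1:
  assumes x: "x \<in> weight_space a" "x \<noteq> 0" "t \<in> T" "a t \<noteq> 0" and y: "y \<in> weight_space a"
  shows "\<exists>c. y = scale c x"
proof (cases "y = 0")
  case True
  then show ?thesis
    by (intro exI[of _ 0]) simp
next
  case False
  have "bracket x y \<in> weight_space (\<lambda>t. 2 * a t)"
    by (rule weight_space_bracketI[OF x(1) y]) simp
  then have "bracket x y = 0"
    by (rule double_root_space_trivial[OF x])
  then show ?thesis
    by (rule commuting_root_vectors_dependent[OF x y False x(3,4)])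
qed

text \<open>Otherwise a + b and then 2a + b carry nonzero vectors [x, y] and [x, [x, y]]. If 2a + b
  = 0, then -a = a + b is a root with double root b. If not, bracketing with \<open>y\<close> gives
  a nonzero vector of weight 2(a + b), the double of the root a + b.\<close>

lemma roots_proportional:
  assumes x: "x \<in> weight_space a" "x \<noteq> 0" "t \<in> T" "a t \<noteq> 0"
    and y: "y \<in> weight_space b" "y \<noteq> 0" "t' \<in> T" "b t' \<noteq> 0"
  shows "(\<forall>t\<in>T. b t = a t) \<or> (\<forall>t\<in>T. b t = - a t)"
proof (rule ccontr)
  assume "\<not> ?thesis"
  then obtain u v where u: "u \<in> T" "b u \<noteq> a u" and v: "v \<in> T" "b v \<noteq> - a v"
    by blast
  have v': "a v + b v \<noteq> 0"
    using v(2) by (simp add: eq_neg_iff_add_eq_0 add.commute)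
  define z1 where "z1 = bracket x y"
  have z1: "z1 \<in> weight_space (\<lambda>t. a t + b t)" "z1 \<noteq> 0"
    unfolding z1_def using root_vectors_bracket_neq_0[OF x y u(1)] u(2)
    by (auto intro: weight_space_bracket x y)
  define z2 where "z2 = bracket x z1"
  have z2: "z2 \<in> weight_space (\<lambda>t. 2 * a t + b t)" "z2 \<noteq> 0"
    unfolding z2_def using root_vectors_bracket_neq_0[OF x z1 v(1) v' y(3)] y(4)
    by (auto intro!: weight_space_bracketI[OF x(1) z1(1)])
  show False
  proof (cases "\<forall>r\<in>T. 2 * a r + b r = 0")
    case True
    then have "b r = 2 * - a r" "a r + b r = - a r" if "r \<in> T" for r
      using that by (simp_all add: eq_neg_iff_add_eq_0 algebra_simps)
    then have "weight_space b = weight_space (\<lambda>t. 2 * - a t)"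
      "weight_space (\<lambda>t. a t + b t) = weight_space (\<lambda>t. - a t)"
      by (intro weight_space_cong; simp)+
    then show False
      using double_root_space_trivial[of z1 "\<lambda>t. - a t" t y] z1 x y by simp
  next
    case False
    then obtain r where r: "r \<in> T" "2 * a r + b r \<noteq> 0"
      by blast
    have "b t \<noteq> 2 * a t + b t"
      using x(4) numeral_neq_0 by simp
    then have "bracket y z2 \<noteq> 0"
      using root_vectors_bracket_neq_0[OF y z2 r x(3)] by blast
    moreover have "bracket y z2 \<in> weight_space (\<lambda>t. 2 * (a t + b t))"
      by (rule weight_space_bracketI[OF y(1) z2(1)]) (simp add: algebra_simps)
    ultimately show False
      using double_root_space_trivial[OF z1 v(1) v'] by blast
  qed
qed

text \<open>Without roots the algebra would be \<open>T\<close>, where the p-map is injective,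
  against the existence of a nonzero p-nilpotent element.\<close>

lemma root_exists:
  obtains a x t where "x \<in> weight_space a" "x \<noteq> 0" "t \<in> T" "a t \<noteq> 0"
proof -
  have "\<exists>a x t. x \<in> weight_space a \<and> x \<noteq> 0 \<and> t \<in> T \<and> a t \<noteq> 0"
  proof (rule ccontr)
    assume neg: "\<not> ?thesis"
    have "x \<in> T" if "x \<in> weight_space a" for a x
    proof (cases "x = 0")
      case False
      with neg that have "weight_space a = weight_space (\<lambda>t. 0)"
        by (intro weight_space_cong) blast
      with that show ?thesis
        using weight_space_0 by simp
    qed (simp add: T_subspace subspace_0)
    then have "span (\<Union>a. weight_space a) \<subseteq> T"
      by (intro span_minimal T_subspace) blast
    then have T: "x \<in> T" for x
      using weight_space_decomposition by blast
    obtain x where "x \<noteq> 0" "pmap x = pmap 0"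
      using p_rank_1_obtains_nilpotent[OF p_rank] pmap_0 by metis
    then show False
      using T_pmap_inj T by (meson inj_onD)
  qed
  then show thesis
    using that by blast
qed

text \<open>The component \<open>v\<close> is left as a vector because -a may fail to be a root, in
  which case it is 0. So one decomposition serves all three cases.\<close>

lemma root_decomposition:
  assumes x: "x \<in> weight_space a" "x \<noteq> 0" "t \<in> T" "a t \<noteq> 0"
  shows "\<exists>s\<in>T. \<exists>c. \<exists>v\<in>weight_space (\<lambda>t. - a t). y = s + scale c x + v"
proof -
  define S where "S = {s + scale c x + v | s c v. s \<in> T \<and> v \<in> weight_space (\<lambda>t. - a t)}"
  have 0: "0 \<in> T" "0 \<in> weight_space (\<lambda>t. - a t)"
    by (simp_all add: T_subspace weight_space_subspace subspace_0)
  have "subspace S"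
  proof (rule subspaceI)
    have "0 = 0 + scale 0 x + 0"
      by simp
    then show "0 \<in> S"
      unfolding S_def using 0 by blast
  next
    fix y z assume "y \<in> S" "z \<in> S"
    then obtain s c v s' c' v' where y: "y = s + scale c x + v" "s \<in> T" "v \<in> weight_space (\<lambda>t. - a t)"
      and z: "z = s' + scale c' x + v'" "s' \<in> T" "v' \<in> weight_space (\<lambda>t. - a t)"
      unfolding S_def by blast
    have "y + z = (s + s') + scale (c + c') x + (v + v')"
      by (simp add: y z scale_left_distrib)
    then show "y + z \<in> S"
      unfolding S_def using y z by (blast intro: subspace_add T_subspace weight_space_subspace)
  next
    fix y r assume "y \<in> S"
    then obtain s c v where y: "y = s + scale c x + v" "s \<in> T" "v \<in> weight_space (\<lambda>t. - a t)"
      unfolding S_def by blast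
    have "scale r y = scale r s + scale (r * c) x + scale r v"
      by (simp add: y scale_right_distrib)
    then show "scale r y \<in> S"
      unfolding S_def using y by (blast intro: subspace_scale T_subspace weight_space_subspace)
  qed
  moreover have "weight_space b \<subseteq> S" for b
  proof
    fix y assume y: "y \<in> weight_space b"
    show "y \<in> S"
    proof (cases "y = 0 \<or> (\<forall>t\<in>T. b t = 0)")
      case True
      then have "y \<in> T"
        using y 0 weight_space_cong[of b "\<lambda>t. 0"] weight_space_0 by auto
      moreover have "y = y + scale 0 x + 0"
        by simp
      ultimately show ?thesis
        unfolding S_def using 0 by blast
    next
      case False
      then consider "\<forall>t\<in>T. b t = a t" | "\<forall>t\<in>T. b t = - a t"
        using roots_proportional[OF x y] by blast
      then show ?thesis
      proof cases
        case 1
        then obtain c where "y = scale c x"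
          using root_space_dim_1[OF x] y weight_space_cong[of b a] by blast
        then have "y = 0 + scale c x + 0"
          by simp
        then show ?thesis
          unfolding S_def using 0 by blast
      next
        case 2
        then have "y \<in> weight_space (\<lambda>t. - a t)"
          using y weight_space_cong[of b "\<lambda>t. - a t"] by auto
        moreover have "y = 0 + scale 0 x + y"
          by simp
        ultimately show ?thesis
          unfolding S_def using 0 by blast
      qed
    qed
  qed
  ultimately have "span (\<Union>b. weight_space b) \<subseteq> S"
    by (intro span_minimal) auto
  then have "y \<in> S"
    using weight_space_decomposition by blast
  then show ?thesis
    unfolding S_def by blast
qed

lemma centerI_root:
  assumes x: "x \<in> weight_space a" "x \<noteq> 0" "t \<in> T" "a t \<noteq> 0" and z: "z \<in> T" "a z = 0"
  shows "z \<in> center"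
proof (rule centerI)
  fix y
  obtain s c v where y: "s \<in> T" "v \<in> weight_space (\<lambda>t. - a t)" "y = s + scale c x + v"
    using root_decomposition[OF x] by blast
  show "bracket z y = 0"
    using weight_spaceD(1)[OF x(1) z(1)] weight_spaceD(1)[OF y(2) z(1)] T_bracket[OF z(1) y(1)] z(2)
    by (simp add: y(3) bracket_add_right bracket_scale_right)
qed

lemma root_span_mod_center:
  assumes x: "x \<in> weight_space a" "x \<noteq> 0" and h: "h \<in> T" "a h \<noteq> 0"
  obtains c d v where "v \<in> weight_space (\<lambda>t. - a t)" "y - (scale c h + scale d x + v) \<in> center"
proof -
  obtain s d v where y: "s \<in> T" "v \<in> weight_space (\<lambda>t. - a t)" "y = s + scale d x + v"
    using root_decomposition[OF x h] by blast
  define c where "c = a s / a h"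
  have "a (s + scale (- c) h) = a s + - c * a h"
    unfolding weight_add[OF x y(1) subspace_scale[OF T_subspace h(1)]] weight_scale[OF x h(1)] ..
  then have "a (s + scale (- c) h) = 0"
    using h(2) by (simp add: c_def)
  moreover have "s + scale (- c) h \<in> T"
    by (intro subspace_add subspace_scale T_subspace y h)
  ultimately have "s + scale (- c) h \<in> center"
    by (intro centerI_root[OF x h])
  then have "y - (scale c h + scale d x + v) \<in> center"
    by (simp add: y(3) algebra_simps)
  then show thesis
    using that y(2) by blast
qed

text \<open>Applying ad h once and twice gives d x - v = 0 and d x + v = 0. Then c is detected by
  the bracket with \<open>x\<close>.\<close>

lemma root_independent_mod_center:
  assumes x: "x \<in> weight_space a" "x \<noteq> 0" and h: "h \<in> T" "a h \<noteq> 0"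
    and v: "v \<in> weight_space (\<lambda>t. - a t)"
    and u: "scale c h + scale d x + v \<in> center"
  shows "c = 0 \<and> d = 0 \<and> v = 0"
proof -
  have hx: "bracket h x = scale (a h) x" "bracket h v = scale (- a h) v"
    using weight_spaceD(1)[OF x(1) h(1)] weight_spaceD(1)[OF v h(1)] by simp_all
  have "scale (a h) (scale d x - v) = bracket h (scale c h + scale d x + v)"
    by (simp add: bracket_add_right bracket_scale_right bracket_self hx scale_right_diff_distrib mult.commute)
  then have xv: "scale d x - v = 0"
    using centerD(2)[OF u, of h] h(2) by (simp del: right_minus_eq)
  have "scale (a h) (scale d x + v) = bracket h (scale d x - v)"
    by (simp add: bracket_diff_right bracket_scale_right hx scale_right_distrib mult.commute)
  then have "scale d x + v = 0"
    using xv h(2) by simp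
  moreover have "v = scale d x"
    using xv by simp
  ultimately have "scale (2 * d) x = 0"
    unfolding mult_2 scale_left_distrib by simp
  then have d: "d = 0"
    using x(2) numeral_neq_0 by simp
  then have "v = 0"
    using xv by simp
  then have "scale c (bracket h x) = 0"
    using centerD(1)[OF u, of x] d by (simp add: bracket_scale_left)
  then show ?thesis
    using d \<open>v = 0\<close> hx(1) h(2) x(2) by simp
qed

text \<open>With trivial center the algebra would itself be the model, in which x and y are
  independent commuting p-nilpotent elements.\<close>

lemma quotient_borel_sl2_minus_imp_center:
  assumes "quotient_algebra center \<cong>\<^sub>p borel_sl2_minus"
  shows "center \<noteq> {0}"
proof
  assume C: "center = {0}"
  define q where "q x = cosets center `` {x}" for x
  define Q where "Q = quotient_algebra center"
  note Q = quotient_center_simps[folded q_def Q_def]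
  obtain f where f: "restricted_iso Q borel_sl2_minus f"
    using assms unfolding restricted_isomorphic_def Q_def by blast
  have carr: "q x \<in> carr Q" for x
    unfolding Q(5) by blast
  have inj: "x = 0" if "f (q x) = f (q 0)" for x
  proof -
    have "q x = q 0"
      using that f carr unfolding restricted_iso_def bij_betw_def by (meson inj_onD)
    then have "x - 0 \<in> center"
      using eq_equiv_class_iff[OF equiv_cosets[OF center_subspace], of x 0]
      by (simp add: q_def cosets_def)
    then show ?thesis
      using C by simp
  qed
  have scl: "f (q (scale c x)) = bm_scale c (f (q x))" for c x
    using f carr Q(2)[of c x] unfolding restricted_iso_def by (metis borel_sl2_minus_def lie_struct.simps(3))
  have br: "f (q (bracket x y)) = bm_bracket (f (q x)) (f (q y))" for x y
    using f carr Q(3)[of x y] unfolding restricted_iso_def by (metis borel_sl2_minus_def lie_struct.simps(4))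
  have pm: "f (q (pmap x)) = bm_pmap (f (q x))" for x
    using f carr Q(4)[of x] unfolding restricted_iso_def by (metis borel_sl2_minus_def lie_struct.simps(5))
  have f0: "f (q 0) = 0"
    using scl[of 0 0] by (cases "f (q 0)") (simp add: zero_prod_def)
  have surj: "\<exists>x. f (q x) = A" for A
  proof -
    have "A \<in> f ` carr Q"
      using f unfolding restricted_iso_def bij_betw_def borel_sl2_minus_def by simp
    then show ?thesis
      unfolding Q(5) by auto
  qed
  obtain x y where x: "f (q x) = (0, 1, 0)" and y: "f (q y) = (0, 0, 1)"
    using surj by metis
  \<comment> \<open>Ensures 0^(CHAR - 1) = 0 in \<open>bm_pmap\<close>; the exponent 0 would give
    1.\<close>
  have "CHAR('k) - 1 > 0"
    using CHAR_ge_5 by simp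
  then have "pmap x = 0" "pmap y = 0" "bracket x y = 0"
    by (intro inj; simp add: pm br x y f0 zero_prod_def)+
  moreover have "x \<noteq> 0" "y \<noteq> 0"
    using x y f0 by (auto simp: zero_prod_def)
  ultimately obtain c where "y = scale c x"
    using p_rank_1_commuting_nullcone[OF p_rank, of x y] by (auto simp: nullcone_def)
  then show False
    using scl[of c x] x y by simp
qed

text \<open>The cases are: -a is not a root; -a is a root but \<open>a\<close> vanishes on [e, f0],
  which is then central; \<open>a\<close> does not vanish there, and e, f0 generate an
  sl(2).\<close>

lemma classification:
  "quotient_algebra center \<cong>\<^sub>p sl2 \<or> quotient_algebra center \<cong>\<^sub>p borel_sl2
    \<or> quotient_algebra center \<cong>\<^sub>p borel_sl2_minus"
proof -
  have p: "CHAR('k) > 2"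
    using CHAR_ge_5 by simp
  obtain a e t where e: "e \<in> weight_space a" "e \<noteq> 0" "t \<in> T" "a t \<noteq> 0"
    by (rule root_exists)
  \<comment> \<open>The toral element with \<open>a\<close>-value c: c = 2 matches diag(1, -1) in
    the Borel subalgebra, and c = 1 matches t in \<open>borel_sl2_minus\<close>.\<close>
  define h where "h c = scale (c / a t) t" for c
  have h: "h c \<in> T" "a (h c) = c" for c
    unfolding h_def using e weight_scale[OF e(1-3), of "c / a t"]
    by (simp_all add: T_subspace subspace_scale)
  have he: "bracket (h c) e = scale c e" for c
    using weight_spaceD(1)[OF e(1) h(1)] h(2) by simp
  show ?thesis
  proof (cases "\<exists>f\<in>weight_space (\<lambda>t. - a t). f \<noteq> 0")
    case False
    define \<psi> where "\<psi> A = scale (A$1$1) (h 2) + scale (A$1$2) e" for A :: "'k^2^2"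
    have neg: "v = 0" if "v \<in> weight_space (\<lambda>t. - a t)" for v
      using False that by blast
    have eh: "bracket e (h 2) = - scale 2 e"
      using he[of 2] bracket_skew[of e "h 2"] by simp
    have "quotient_algebra center \<cong>\<^sub>p borel_sl2"
      unfolding borel_sl2_def
    proof (rule quotient_center_iso_matrix[where \<psi> = \<psi>, OF p])
      fix A B :: "'k^2^2"
      show "\<psi> (A + B) = \<psi> A + \<psi> B"
        by (simp add: \<psi>_def scale_left_distrib)
      show "\<psi> (\<chi> i j. c * A$i$j) = scale c (\<psi> A)" for c
        by (simp add: \<psi>_def scale_right_distrib)
      assume A: "A \<in> {A. trace A = 0 \<and> A$2$1 = 0}"
      then have A': "A$2$2 = - A$1$1" "A$2$1 = 0"
        by (auto simp: trace_def sum_2 eq_neg_iff_add_eq_0 add.commute)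
      show "(\<chi> i j. c * A$i$j) \<in> {A. trace A = 0 \<and> A$2$1 = 0}" for c
        using A' by (simp add: trace_def sum_2)
      show "A = 0" if "\<psi> A \<in> center"
        using root_independent_mod_center[OF e(1,2) h(1), of 2 0 "A$1$1" "A$1$2"] h(2) numeral_neq_0 that A'
        by (intro matrix2_eqI) (simp_all add: \<psi>_def weight_space_subspace subspace_0)
      assume B: "B \<in> {A. trace A = 0 \<and> A$2$1 = 0}"
      then have B': "B$2$2 = - B$1$1" "B$2$1 = 0"
        by (auto simp: trace_def sum_2 eq_neg_iff_add_eq_0 add.commute)
      show "A + B \<in> {A. trace A = 0 \<and> A$2$1 = 0}"
        "A ** B - B ** A \<in> {A. trace A = 0 \<and> A$2$1 = 0}"
        using A' B' by (simp_all add: trace_def sum_2 matrix_matrix_mult_def)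
      have "\<psi> (A ** B - B ** A) = bracket (\<psi> A) (\<psi> B)"
        by (simp add: \<psi>_def A' B' matrix_matrix_mult_def sum_2 bracket_add_left bracket_add_right
            bracket_scale_left bracket_scale_right bracket_self he eh bracket_minus_right scale_left_diff_distrib
            flip: scale_left_distrib) (simp add: algebra_simps flip: scale_left_distrib)
      then show "\<psi> (A ** B - B ** A) - bracket (\<psi> A) (\<psi> B) \<in> center"
        by (simp add: center_subspace subspace_0)
    next
      fix y
      obtain c d v where cd: "v \<in> weight_space (\<lambda>t. - a t)" "y - (scale c (h 2) + scale d e + v) \<in> center"
        using root_span_mod_center[OF e(1,2) h(1), of 2] h(2) numeral_neq_0 by metis
      then show "\<exists>A\<in>{A. trace A = 0 \<and> A$2$1 = 0}. y - \<psi> A \<in> center"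
        using neg[OF cd(1)]
        by (intro bexI[of _ "vector [vector [c, d], vector [0, - c]]"]) (simp_all add: \<psi>_def trace_def sum_2)
    qed (simp_all add: trace_def sum_2)
    then show ?thesis
      by blast
  next
    case True
    then obtain f0 where f0: "f0 \<in> weight_space (\<lambda>t. - a t)" "f0 \<noteq> 0"
      by blast
    have f0_dim: "\<exists>c. v = scale c f0" if "v \<in> weight_space (\<lambda>t. - a t)" for v
      using root_space_dim_1[OF f0 e(3)] e(4) that by simp
    have ef0: "bracket e f0 \<in> T"
      using weight_space_bracket_T[OF e(1) f0(1)] by simp
    show ?thesis
    proof (cases "a (bracket e f0) = 0")
      case True
      have "quotient_algebra center \<cong>\<^sub>p borel_sl2_minus"
      proof (rule quotient_center_iso_borel_sl2_minus[OF p, of "h 1" e f0])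
        show "bracket (h 1) e = e" "bracket (h 1) f0 = - f0"
          using he[of 1] weight_spaceD(1)[OF f0(1) h(1), of 1] h(2) by simp_all
        show "bracket e f0 \<in> center"
          by (rule centerI_root[OF e ef0 True])
        show "b = 0 \<and> c = 0 \<and> d = 0" if "scale b (h 1) + scale c e + scale d f0 \<in> center" for b c d
          using root_independent_mod_center[OF e(1,2) h(1), of 1 "scale d f0" b c] that h(2) f0
          by (simp add: weight_space_subspace subspace_scale)
        show "\<exists>b c d. y - (scale b (h 1) + scale c e + scale d f0) \<in> center" for y
        proof -
          obtain c d v where cd: "v \<in> weight_space (\<lambda>t. - a t)" "y - (scale c (h 1) + scale d e + v) \<in> center"
            using root_span_mod_center[OF e(1,2) h(1), of 1] h(2) by (metis one_neq_zero)
          then show ?thesis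
            using f0_dim[OF cd(1)] by blast
        qed
      qed
      then show ?thesis
        by blast
    next
      case False
      define f where "f = scale (2 / a (bracket e f0)) f0"
      define k where "k = bracket e f"
      have f: "f \<in> weight_space (\<lambda>t. - a t)" "f \<noteq> 0"
        using f0 False numeral_neq_0 by (simp_all add: f_def weight_space_subspace subspace_scale)
      have k: "k \<in> T" "a k = 2"
        using weight_space_bracket_T[OF e(1) f(1)] weight_scale[OF e(1,2) ef0] False
        by (simp_all add: k_def f_def bracket_scale_right)
      have brk: "bracket k e = scale 2 e" "bracket e k = - scale 2 e"
        "bracket k f = - scale 2 f" "bracket f k = scale 2 f" "bracket e f = k" "bracket f e = - k"
        using weight_spaceD[OF e(1) k(1)] weight_spaceD[OF f(1) k(1)] k(2) bracket_skew[of f e]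
        by (simp_all add: k_def)
      define \<psi> where "\<psi> A = scale (A$1$1) k + scale (A$1$2) e + scale (A$2$1) f" for A :: "'k^2^2"
      have "quotient_algebra center \<cong>\<^sub>p sl2"
        unfolding sl2_def
      proof (rule quotient_center_iso_matrix[where \<psi> = \<psi>, OF p])
        fix A B :: "'k^2^2"
        show "\<psi> (A + B) = \<psi> A + \<psi> B"
          by (simp add: \<psi>_def scale_left_distrib)
        show "\<psi> (\<chi> i j. c * A$i$j) = scale c (\<psi> A)" for c
          by (simp add: \<psi>_def scale_right_distrib)
        assume A: "A \<in> {A. trace A = 0}"
        then have A': "A$2$2 = - A$1$1"
          by (auto simp: trace_def sum_2 eq_neg_iff_add_eq_0 add.commute)
        show "(\<chi> i j. c * A$i$j) \<in> {A. trace A = 0}" for c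
          using A' by (simp add: trace_def sum_2)
        show "A = 0" if "\<psi> A \<in> center"
          using root_independent_mod_center[OF e(1,2) k(1), of "scale (A$2$1) f" "A$1$1" "A$1$2"]
            k(2) numeral_neq_0 f that A'
          by (intro matrix2_eqI) (simp_all add: \<psi>_def weight_space_subspace subspace_scale)
        assume B: "B \<in> {A. trace A = 0}"
        then have B': "B$2$2 = - B$1$1"
          by (auto simp: trace_def sum_2 eq_neg_iff_add_eq_0 add.commute)
        show "A + B \<in> {A. trace A = 0}" "A ** B - B ** A \<in> {A. trace A = 0}"
          using A' B' by (simp_all add: trace_def sum_2 matrix_matrix_mult_def)
        have "\<psi> (A ** B - B ** A) = scale (A$1$2 * B$2$1 - A$2$1 * B$1$2) k
            + scale (2 * A$1$1 * B$1$2 - 2 * A$1$2 * B$1$1) e + scale (2 * A$2$1 * B$1$1 - 2 * A$1$1 * B$2$1) f"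
          by (simp add: \<psi>_def A' B' matrix_matrix_mult_def sum_2 algebra_simps)
        also have "\<dots> = bracket (\<psi> A) (\<psi> B)"
          by (simp add: \<psi>_def bracket_add_left bracket_add_right bracket_scale_left bracket_scale_right
              bracket_self brk bracket_minus_right scale_left_diff_distrib
              scale_right_distrib scale_right_diff_distrib mult_ac)
        finally show "\<psi> (A ** B - B ** A) - bracket (\<psi> A) (\<psi> B) \<in> center"
          by (simp add: center_subspace subspace_0)
      next
        fix y
        obtain c d v where cd: "v \<in> weight_space (\<lambda>t. - a t)" "y - (scale c k + scale d e + v) \<in> center"
          using root_span_mod_center[OF e(1,2) k(1)] k(2) numeral_neq_0 by metis
        obtain r where "v = scale r f"
          using root_space_dim_1[OF f e(3)] e(4) cd(1) by auto
        then show "\<exists>A\<in>{A. trace A = 0}. y - \<psi> A \<in> center"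
          using cd
          by (intro bexI[of _ "vector [vector [c, d], vector [r, - c]]"]) (simp_all add: \<psi>_def trace_def sum_2)
      qed (simp_all add: trace_def sum_2)
      then show ?thesis
        by blast
    qed
  qed
qed

end

theorem theorem4p2p4:
  fixes scale :: "'k::alg_closed_field \<Rightarrow> 'g::ab_group_add \<Rightarrow> 'g"
    and bracket :: "'g \<Rightarrow> 'g \<Rightarrow> 'g"
    and pmap :: "'g \<Rightarrow> 'g"
  assumes "CHAR('k) \<ge> 5"
    and "fin_dim_restricted_lie_algebra scale bracket pmap"
    and "restricted_lie_algebra.generically_toral scale bracket pmap"
    and "fin_dim_restricted_lie_algebra.p_rank scale bracket pmap = 1"
  defines "C \<equiv> lie_algebra.center bracket"
  defines "Q \<equiv> restricted_lie_algebra.quotient_algebra scale bracket pmap C"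
  shows "(Q \<cong>\<^sub>p sl2 \<or> Q \<cong>\<^sub>p borel_sl2 \<or> Q \<cong>\<^sub>p borel_sl2_minus)
    \<and> (Q \<cong>\<^sub>p borel_sl2_minus \<longrightarrow> C \<noteq> {0})"
proof -
  interpret fin_dim_restricted_lie_algebra scale bracket pmap
    by (rule assms(2))
  obtain T where "torus T" "self_centralizing T"
    using assms(3) unfolding generically_toral_def by blast
  then interpret toral_p_rank_1 scale bracket pmap T
    by unfold_locales (use assms(1,4) in simp_all)
  show ?thesis
    unfolding Q_def C_def using classification quotient_borel_sl2_minus_imp_center by blast
qed

end
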